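(* Let $\alpha_1<1/2$ and $\rho>\rho_c$. Then only the ground state is macroscopically occupied (BEC of type I): $$\lim_{V\to\infty}\frac1V\langle N_{\mathbf{n}}\rangle^C_V(\rho)=\begin{cases}\rho-\rho_c,&\mathbf{n}=(1,1,1),\\0,&\mathbf{n}\neq(1,1,1).\end{cases}$$
   Context: Fix exponents $\alpha_1\ge\alpha_2\ge\alpha_3>0$ with $\alpha_1+\alpha_2+\alpha_3=1$ and $\Lambda_V=\{x\in\mathbb{R}^3:0\le x_j\le V^{\alpha_j}\}$. The one-particle Hamiltonian $-\Delta/2$ on $L^2(\Lambda_V)$ with Dirichlet boundary conditions has eigenvalues $\epsilon_{\mathbf{n},V}=\frac{\pi^2}{2}\sum_jn_j^2V^{-2\alpha_j}$, $\mathbf{n}\in\mathbb{N}^3$, $n_j\ge1$; $N_{\mathbf{n}}$ is the occupation number of the eigenstate indexed by $\mathbf{n}$. Perfect Bose gas at inverse temperature $\beta>0$; canonical state at density $\rho=N/V$: $\langle\cdot\rangle^C_V(\rho)=Z_V(N)^{-1}\mathrm{Tr}(\cdot\,e^{-\beta T_V^{(N)}})$ on the symmetric $N$-particle space; limit at fixed $\rho$: $N$ particles in volume $V=N/\rho$, $N\to\infty$. $F(\eta)=\frac{\sqrt2}{3\pi^2}\eta^{3/2}$, $\rho_c=\int_0^\infty(e^{\beta\eta}-1)^{-1}F(d\eta)$. *)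

theory Defs
  imports "HOL-Analysis.Analysis"
begin

type_synonym mode = "nat \<times> nat \<times> nat"

text \<open>Index set of the Dirichlet eigenstates: n = (n1,n2,n3) with n_j >= 1.\<close>
definition modes :: "mode set" where
  "modes = {(n1, n2, n3). 1 \<le> n1 \<and> 1 \<le> n2 \<and> 1 \<le> n3}"

text \<open>One-particle eigenvalues of -Delta/2 with Dirichlet b.c. in the box
  [0,V^a1] x [0,V^a2] x [0,V^a3].\<close>
definition eps :: "real \<Rightarrow> real \<Rightarrow> real \<Rightarrow> real \<Rightarrow> mode \<Rightarrow> real" where
  "eps a1 a2 a3 V n = (case n of (n1, n2, n3) \<Rightarrow>
     pi^2 / 2 * (real n1 ^ 2 * V powr (-2 * a1) + real n2 ^ 2 * V powr (-2 * a2)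
                 + real n3 ^ 2 * V powr (-2 * a3)))"

text \<open>Occupation-number basis of the symmetric N-particle space:
  finitely supported occupation functions on the modes with total occupation N.\<close>
definition configs :: "nat \<Rightarrow> (mode \<Rightarrow> nat) set" where
  "configs N = {m. finite {k. m k \<noteq> 0} \<and> {k. m k \<noteq> 0} \<subseteq> modes
                   \<and> (\<Sum>k\<in>{k. m k \<noteq> 0}. m k) = N}"

definition energy :: "(mode \<Rightarrow> real) \<Rightarrow> (mode \<Rightarrow> nat) \<Rightarrow> real" where
  "energy e m = (\<Sum>k\<in>{k. m k \<noteq> 0}. real (m k) * e k)"

text \<open>Canonical partition function Z_V(N) = Tr exp(-beta T_V^(N)).\<close>
definition Zcan :: "real \<Rightarrow> (mode \<Rightarrow> real) \<Rightarrow> nat \<Rightarrow> real" where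
  "Zcan \<beta> e N = infsum (\<lambda>m. exp (- \<beta> * energy e m)) (configs N)"

definition occ_can :: "real \<Rightarrow> (mode \<Rightarrow> real) \<Rightarrow> nat \<Rightarrow> mode \<Rightarrow> real" where
  "occ_can \<beta> e N n =
     infsum (\<lambda>m. real (m n) * exp (- \<beta> * energy e m)) (configs N) / Zcan \<beta> e N"

text \<open>F(eta) = sqrt 2/(3 pi^2) eta^(3/2); F(d eta) = F'(eta) d eta.\<close>
definition Fdens :: "real \<Rightarrow> real" where
  "Fdens \<eta> = sqrt 2 / (3 * pi^2) * (3/2) * sqrt \<eta>"

definition rho_c :: "real \<Rightarrow> real" where
  "rho_c \<beta> = (LINT \<eta>:{0<..}|lborel. (1 / (exp (\<beta> * \<eta>) - 1)) * Fdens \<eta>)"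

end

theory Submission
  imports Defs "HOL-Probability.Distributions" "HOL-Real_Asymp.Real_Asymp"
begin

text \<open>
  Measure energies from the ground state and write \<open>T N\<close> for the canonical partition function. Adding
  ground-state particles costs nothing, so \<open>T\<close> increases, and \<open>w n = T n - T (n - 1)\<close> is the weight of
  having \<open>n\<close> excited particles: the canonical law of the number of excited particles is the
  grand-canonical one at the critical chemical potential, conditioned to be at most \<open>N\<close>. Counting
  particles mode by mode gives \<open>n * w n = (\<Sum>j\<ge>1. S j * w (n - j))\<close>, where \<open>S j\<close> sums the \<open>j\<close>-th
  powers of the excited Boltzmann factors. Hence the unconditioned law has mean \<open>a = (\<Sum>j. S j)\<close> and
  variance \<open>(\<Sum>j. j * S j)\<close>, at most \<open>a\<close> divided by one minus the largest excited Boltzmann factor,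
  and Chebyshev's inequality shows that for \<open>N > a\<close> the conditioning changes the mean only slightly.
  Since \<open>a1 < 1/2\<close>, the spectral gap is much larger than \<open>1 / V\<close>, so the variance is \<open>o(V\<^sup>2)\<close> and every
  single excited mode contributes \<open>o(V)\<close>. Finally \<open>S j\<close> factorises into three one-dimensional theta
  sums; comparing these with Gaussian integrals gives \<open>S j / V \<longlonglongrightarrow> (2 * pi * \<beta> * j) powr (-3/2)\<close>, and
  dominated convergence gives \<open>a / V \<longlonglongrightarrow> rho_c \<beta>\<close>.
\<close>

section \<open>A renewal recursion\<close>

text \<open>Shifting the index bounds each weighted partial sum by \<open>a\<close> plus
  \<open>r\<close> times the previous one, and \<open>a / (1 - r)\<close> is the fixed point of this
  recursion. Working with partial sums makes convergence a result. This is how the spectral gap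
  enters the variance bound.\<close>

lemma sum_weighted_le_of_ratio:
  fixes S :: "nat \<Rightarrow> real"
  assumes nn: "\<And>j. S j \<ge> 0" and S: "S sums a" and r: "r < 1" "r \<ge> 0"
    and ratio: "\<And>j. j \<ge> 1 \<Longrightarrow> S (Suc j) \<le> r * S j"
  shows "summable (\<lambda>j. real j * S j)" "(\<Sum>j. real j * S j) \<le> a / (1 - r)"
proof -
  have part: "(\<Sum>j<n. S j) \<le> a" for n
    using sum_le_suminf[of S "{..<n}"] S nn by (auto simp: sums_iff)
  have rec: "(\<Sum>j<Suc n. real j * S j) \<le> a + r * (\<Sum>j<n. real j * S j)" for n
  proof -
    have "(\<Sum>j<Suc n. real j * S j) = (\<Sum>j<n. real (Suc j) * S (Suc j))"
      by (subst sum.lessThan_Suc_shift) simp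
    also have "\<dots> = (\<Sum>j<n. S (Suc j)) + (\<Sum>j<n. real j * S (Suc j))"
      by (simp add: sum.distrib algebra_simps)
    also have "(\<Sum>j<n. S (Suc j)) \<le> (\<Sum>j<Suc n. S j)"
      using nn[of 0] by (subst sum.lessThan_Suc_shift) simp
    also have "\<dots> \<le> a" by (rule part)
    also have "(\<Sum>j<n. real j * S (Suc j)) \<le> (\<Sum>j<n. r * (real j * S j))"
    proof (intro sum_mono)
      fix j show "real j * S (Suc j) \<le> r * (real j * S j)"
        using ratio[of j] mult_left_mono[of "S (Suc j)" "r * S j" "real j"]
        by (cases "j = 0") (auto simp: algebra_simps)
    qed
    finally show ?thesis by (simp add: sum_distrib_left algebra_simps)
  qed
  have bnd: "(\<Sum>j<n. real j * S j) \<le> a / (1 - r)" for n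
  proof (induction n)
    case 0 then show ?case using part[of 0] r by simp
  next
    case (Suc n)
    have "(\<Sum>j<Suc n. real j * S j) \<le> a + r * (a / (1 - r))"
      using rec[of n] mult_left_mono[OF Suc r(2)] by linarith
    also have "\<dots> = a / (1 - r)" using r by (simp add: field_simps)
    finally show ?case .
  qed
  show sm: "summable (\<lambda>j. real j * S j)"
    by (rule summableI_nonneg_bounded[OF _ bnd]) (simp add: nn)
  show "(\<Sum>j. real j * S j) \<le> a / (1 - r)"
    by (rule suminf_le_const[OF sm bnd])
qed

text \<open>For generating functions the recursion reads \<open>z W'(z) = S(z) W(z)\<close>. At
  \<open>z = 1\<close> it gives mean \<open>a\<close>, and differentiated once more variance
  \<open>b\<close>, for the normalised weights. The upper bound comes from exchanging the sums and
  extending each inner sum to \<open>N\<close>; the lower bound estimates the lost tail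
  \<open>n > N\<close> by Chebyshev's inequality.\<close>

lemma renewal_bounds:
  fixes w S :: "nat \<Rightarrow> real"
  assumes w: "\<And>n. w n \<ge> 0" and nn: "\<And>j. S j \<ge> 0"
    and S: "S sums a" and b: "(\<lambda>j. real j * S j) sums b"
    and rec: "\<And>n. real n * w n = (\<Sum>j\<le>n. S j * w (n - j))"
  shows "(\<Sum>n\<le>N. real n * w n) \<le> a * (\<Sum>n\<le>N. w n)"
    and "real N > a \<Longrightarrow>
      (a - real N * b / (real N - a)^2) * (\<Sum>n\<le>N. w n) \<le> (\<Sum>n\<le>N. real n * w n)"
proof -
  have a0: "a \<ge> 0" by (rule sums_le[OF _ sums_zero S]) (simp add: nn)
  have b0: "b \<ge> 0" by (rule sums_le[OF _ sums_zero b]) (simp add: nn)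
  have T1: "(\<Sum>n\<le>N. real n * w n) \<le> a * (\<Sum>n\<le>N. w n)" for N
  proof -
    have "(\<Sum>n\<le>N. real n * w n) = (\<Sum>n\<le>N. \<Sum>j\<le>n. S j * w (n - j))"
      by (simp add: rec)
    also have "\<dots> = (\<Sum>j\<le>N. \<Sum>n\<in>{j..N}. S j * w (n - j))"
      by (simp add: sum.Sigma, rule sum.reindex_bij_witness[where i="\<lambda>(a,b). (b,a)" and j="\<lambda>(a,b). (b,a)"]) auto
    also have "\<dots> \<le> (\<Sum>j\<le>N. S j * (\<Sum>n\<le>N. w n))"
    proof (rule sum_mono)
      fix j assume "j \<in> {..N}"
      have "(\<Sum>n\<in>{j..N}. w (n - j)) = (\<Sum>n\<in>{0..N-j}. w n)"
        using \<open>j \<in> {..N}\<close> by (intro sum.reindex_bij_witness[where i="\<lambda>n. n + j" and j="\<lambda>n. n - j"]) auto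
      also have "\<dots> \<le> (\<Sum>n\<le>N. w n)" by (rule sum_mono2) (auto simp: w)
      finally show "(\<Sum>n\<in>{j..N}. S j * w (n - j)) \<le> S j * (\<Sum>n\<le>N. w n)"
        using nn by (simp add: sum_distrib_left[symmetric] mult_left_mono)
    qed
    also have "\<dots> \<le> a * (\<Sum>n\<le>N. w n)"
      using sum_le_suminf[of S "{..N}"] S nn w
      by (auto simp: sums_iff sum_distrib_right[symmetric] intro!: mult_right_mono sum_nonneg)
    finally show ?thesis .
  qed
  then show "(\<Sum>n\<le>N. real n * w n) \<le> a * (\<Sum>n\<le>N. w n)" .
  have sw: "summable w"
  proof -
    \<comment> \<open>From \<open>M\<close> on, \<open>real n - a\<close> is at least 1; below
      \<open>M\<close> the extra \<open>a + 1\<close> makes up for its negative values. By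
      \<open>T1\<close> the terms \<open>(real n - a) * w n\<close> sum to at most 0, so a fixed
      finite sum bounds all partial sums of \<open>w\<close>.\<close>
    define M where "M = nat \<lceil>a + 1\<rceil>"
    have M: "real M \<ge> a + 1" unfolding M_def using a0 by linarith
    have "(\<Sum>n<N. w n) \<le> (a + 1) * (\<Sum>n<M. w n)" for N
    proof -
      have "(\<Sum>n\<le>N. w n) \<le> (\<Sum>n\<le>N. (real n - a) * w n + (a + 1) * (if n < M then w n else 0))"
      proof (rule sum_mono)
        fix n
        have "w n * 1 \<le> w n * (real n - a + (a + 1) * (if n < M then 1 else 0))"
          by (rule mult_left_mono) (use M a0 w in auto)
        then show "w n \<le> (real n - a) * w n + (a + 1) * (if n < M then w n else 0)"
          by (auto simp: algebra_simps split: if_splits)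
      qed
      also have "\<dots> = (\<Sum>n\<le>N. real n * w n) - a * (\<Sum>n\<le>N. w n)
          + (a + 1) * (\<Sum>n\<le>N. if n < M then w n else 0)"
        by (simp add: sum.distrib sum_subtractf sum_distrib_left algebra_simps)
      also have "\<dots> \<le> (a + 1) * (\<Sum>n\<le>N. if n < M then w n else 0)"
        using T1[of N] by simp
      also have "(\<Sum>n\<le>N. if n < M then w n else 0) = (\<Sum>n\<in>{n\<in>{..N}. n < M}. w n)"
        by (rule sum.inter_filter[symmetric]) simp
      also have "\<dots> \<le> (\<Sum>n<M. w n)"
        by (rule sum_mono2) (auto simp: w)
      finally have "(\<Sum>n\<le>N. w n) \<le> (a + 1) * (\<Sum>n<M. w n)" using a0 by (simp add: mult_left_mono)
      moreover have "(\<Sum>n<N. w n) \<le> (\<Sum>n\<le>N. w n)" by (rule sum_mono2) (auto simp: w)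
      ultimately show ?thesis by simp
    qed
    then show ?thesis by (intro summableI_nonneg_bounded[of w]) (auto simp: w)
  qed
  define X where "X = (\<Sum>n. w n)"
  have X: "w sums X" unfolding X_def using sw by (rule summable_sums)
  have s1: "(\<lambda>n. real n * w n) sums (a * X)"
    using Cauchy_product_sums[of S w] S sw nn w rec by (simp add: X_def sums_iff)
  \<comment> \<open>Writing \<open>n = j + (n - j)\<close> under the recursion splits
    \<open>real n ^ 2 * w n\<close> into two Cauchy products, one of mass \<open>b * X\<close> and
    one of mass \<open>a * (a * X)\<close>.\<close>
  have s2: "(\<lambda>n. real n ^ 2 * w n) sums (b * X + a * (a * X))"
  proof -
    have "(\<lambda>n. \<Sum>j\<le>n. (real j * S j) * w (n - j)) sums (b * X)"
      using Cauchy_product_sums[of "\<lambda>j. real j * S j" w] b sw nn w by (simp add: X_def sums_iff abs_mult)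
    moreover have "(\<lambda>n. \<Sum>j\<le>n. S j * (real (n - j) * w (n - j))) sums (a * (a * X))"
      using Cauchy_product_sums[of S "\<lambda>j. real j * w j"] S s1 nn w by (simp add: sums_iff abs_mult)
    ultimately have "(\<lambda>n. (\<Sum>j\<le>n. (real j * S j) * w (n - j))
        + (\<Sum>j\<le>n. S j * (real (n - j) * w (n - j)))) sums (b * X + a * (a * X))"
      by (rule sums_add)
    moreover have "(\<Sum>j\<le>n. (real j * S j) * w (n - j)) + (\<Sum>j\<le>n. S j * (real (n - j) * w (n - j)))
        = real n ^ 2 * w n" for n
    proof -
      have "real n ^ 2 * w n = real n * (\<Sum>j\<le>n. S j * w (n - j))"
        by (simp add: power2_eq_square rec[symmetric])
      also have "\<dots> = (\<Sum>j\<le>n. (real j * S j) * w (n - j) + S j * (real (n - j) * w (n - j)))"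
        unfolding sum_distrib_left
        by (rule sum.cong) (auto simp: of_nat_diff algebra_simps)
      finally show ?thesis by (simp add: sum.distrib)
    qed
    ultimately show ?thesis by simp
  qed
  have s3: "(\<lambda>n. (real n - a)^2 * w n) sums (b * X)"
  proof -
    have "(\<lambda>n. real n ^ 2 * w n - 2 * a * (real n * w n) + a^2 * w n) sums
        (b * X + a * (a * X) - 2 * a * (a * X) + a^2 * X)"
      by (intro sums_add sums_diff sums_mult s1 s2 X)
    then show ?thesis by (simp add: power2_eq_square algebra_simps)
  qed
  assume N: "real N > a"
  \<comment> \<open>For \<open>n > a\<close> the ratio \<open>n / (n - a)^2\<close> decreases, and
    \<open>c\<close> is its value at \<open>N\<close>. Hence the first moment of the tail beyond
    \<open>N\<close> is at most \<open>c\<close> times the second moment about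
    \<open>a\<close>.\<close>
  define c where "c = real N / (real N - a)^2"
  have c0: "c \<ge> 0" by (simp add: c_def)
  have le: "real n \<le> c * (real n - a)^2" if "n > N" for n
  proof -
    have "real N * real n \<ge> a * a" using that N a0 by (intro mult_mono) auto
    then have "0 \<le> (real n - real N) * (real N * real n - a * a)" using that by simp
    also have "\<dots> = real N * (real n - a)^2 - real n * (real N - a)^2"
      by (simp add: power2_eq_square algebra_simps)
    finally show ?thesis using N by (simp add: c_def field_simps)
  qed
  have "a * X \<le> (\<Sum>n\<le>N. real n * w n) + c * (b * X)"
  proof (rule sums_le)
    show "(\<lambda>n. real n * w n) sums (a * X)" by (rule s1)
    have "(\<lambda>n. if n \<in> {..N} then real n * w n else 0) sums (\<Sum>n\<le>N. real n * w n)"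
      by (rule sums_If_finite_set) simp
    then show "(\<lambda>n. (if n \<in> {..N} then real n * w n else 0) + c * ((real n - a)^2 * w n))
      sums ((\<Sum>n\<le>N. real n * w n) + c * (b * X))"
      by (intro sums_add sums_mult s3)
    fix n
    have "real n * w n \<le> c * (real n - a)^2 * w n" if "n > N"
      using le[OF that] w by (rule mult_right_mono)
    then show "real n * w n \<le> (if n \<in> {..N} then real n * w n else 0) + c * ((real n - a)^2 * w n)"
      using c0 w[of n] by (auto simp: not_le mult.assoc)
  qed
  then have low: "(a - c * b) * X \<le> (\<Sum>n\<le>N. real n * w n)" by (simp add: algebra_simps)
  have TX: "(\<Sum>n\<le>N. w n) \<le> X" using sum_le_suminf[OF sw, of "{..N}"] w by (simp add: X_def)
  have T0: "(\<Sum>n\<le>N. w n) \<ge> 0" by (simp add: sum_nonneg w)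
  \<comment> \<open>\<open>low\<close> contains the full mass \<open>X\<close>, the claim only the
    mass up to \<open>N\<close>. Reducing the mass is harmless for a nonnegative factor; for a
    negative factor the left side is at most 0 anyway.\<close>
  have "(a - c * b) * (\<Sum>n\<le>N. w n) \<le> (\<Sum>n\<le>N. real n * w n)"
  proof (cases "a - c * b \<ge> 0")
    case True
    then show ?thesis using mult_left_mono[OF TX True] low by linarith
  next
    case False
    then have "(a - c * b) * (\<Sum>n\<le>N. w n) \<le> 0" using T0 by (simp add: mult_nonpos_nonneg)
    also have "0 \<le> (\<Sum>n\<le>N. real n * w n)" by (simp add: sum_nonneg w)
    finally show ?thesis .
  qed
  then show "(a - real N * b / (real N - a)^2) * (\<Sum>n\<le>N. w n) \<le> (\<Sum>n\<le>N. real n * w n)"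
    by (simp add: c_def)
qed

text \<open>\<open>T\<close> is the partial sum of the weights of \<open>renewal_bounds\<close>.\<close>
lemma partial_renewal_bounds:
  fixes T S :: "nat \<Rightarrow> real"
  assumes T0: "T 0 > 0" and T: "incseq T" and nn: "\<And>j. S j \<ge> 0"
    and S: "(\<lambda>j. S (Suc j)) sums a" and r: "r < 1" "r \<ge> 0"
    and ratio: "\<And>j. j \<ge> 1 \<Longrightarrow> S (Suc j) \<le> r * S j"
    and rec: "\<And>N. real N * T N = (\<Sum>j=1..N. (1 + S j) * T (N - j))"
  shows "(\<Sum>j=1..N. S j * T (N - j)) \<le> a * T N"
    and "real N > a \<Longrightarrow>
      (a - real N * (a / (1 - r)) / (real N - a)^2) * T N \<le> (\<Sum>j=1..N. S j * T (N - j))"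
proof -
  \<comment> \<open>\<open>S 0\<close> is arbitrary, whereas \<open>renewal_bounds\<close> sums from
    index 0; setting it to zero removes the spurious term.\<close>
  define S' where "S' = (\<lambda>j. if j = 0 then 0 else S j)"
  define w where "w = (\<lambda>n. case n of 0 \<Rightarrow> T 0 | Suc m \<Rightarrow> T (Suc m) - T m)"
  define D where "D = (\<lambda>N. \<Sum>j\<le>N. S' j * T (N - j))"
  have wsum: "(\<Sum>n\<le>N. w n) = T N" for N
    by (induction N) (auto simp: w_def)
  have w: "w n \<ge> 0" for n
    using T T0 by (auto simp: w_def incseq_Suc_iff split: nat.split)
  have D: "D N = (\<Sum>j=1..N. S j * T (N - j))" for N
    unfolding D_def by (rule sum.mono_neutral_cong_right) (auto simp: S'_def)
  \<comment> \<open>The 1 in \<open>1 + S j\<close> is the ground state's share and produces the sum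
    of all earlier values of \<open>T\<close>. In the difference of two consecutive instances it
    leaves \<open>T m\<close>, which turns \<open>Suc m * T (Suc m) - m * T m\<close> into
    \<open>Suc m * w (Suc m)\<close>.\<close>
  have TN: "real N * T N = D N + (\<Sum>n<N. T n)" for N
  proof -
    have "(\<Sum>j=1..N. T (N - j)) = (\<Sum>n<N. T n)"
      by (rule sum.reindex_bij_witness[where i="\<lambda>n. N - n" and j="\<lambda>n. N - n"]) auto
    then show ?thesis by (simp add: rec D sum.distrib algebra_simps)
  qed
  have wrec: "real n * w n = (\<Sum>j\<le>n. S' j * w (n - j))" for n
  proof (cases n)
    case 0 then show ?thesis by (simp add: S'_def)
  next
    case (Suc m)
    have "real n * w n = D (Suc m) - D m"
      using TN[of "Suc m"] TN[of m] by (simp add: w_def Suc algebra_simps)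
    also have "\<dots> = (\<Sum>j\<le>m. S' j * (T (Suc m - j) - T (m - j))) + S' (Suc m) * T 0"
      by (simp add: D_def sum_subtractf algebra_simps)
    also have "\<dots> = (\<Sum>j\<le>m. S' j * w (Suc m - j)) + S' (Suc m) * w 0"
      by (intro arg_cong2[where f="(+)"] sum.cong) (auto simp: w_def Suc_diff_le)
    finally show ?thesis by (simp add: Suc)
  qed
  have DT: "(\<Sum>n\<le>N. real n * w n) = D N" for N
  proof (induction N)
    case 0 then show ?case by (simp add: D_def S'_def)
  next
    case (Suc m)
    have "real (Suc m) * w (Suc m) = D (Suc m) - D m"
      using TN[of "Suc m"] TN[of m] by (simp add: w_def algebra_simps)
    with Suc show ?case by simp
  qed
  have S': "S' sums a"
    using S sums_Suc[of S' a] by (simp add: S'_def)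
  have nn': "S' j \<ge> 0" for j by (simp add: S'_def nn)
  have ratio': "S' (Suc j) \<le> r * S' j" if "j \<ge> 1" for j
    using ratio[OF that] that by (simp add: S'_def)
  note sm = sum_weighted_le_of_ratio[where S = S', OF nn' S' r ratio']
  define b where "b = (\<Sum>j. real j * S' j)"
  have b: "(\<lambda>j. real j * S' j) sums b" using sm(1) unfolding b_def by (rule summable_sums)
  note R = renewal_bounds[where w = w and S = S', OF w nn' S' b wrec, of N, unfolded wsum DT D]
  show "(\<Sum>j=1..N. S j * T (N - j)) \<le> a * T N" by (rule R(1))
  assume N: "real N > a"
  have TN0: "T N \<ge> 0" using T0 incseqD[OF T, of 0 N] by simp
  have "real N * b / (real N - a)^2 \<le> real N * (a / (1 - r)) / (real N - a)^2"
    using sm(2) by (intro divide_right_mono mult_left_mono) (auto simp: b_def)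
  then have "(a - real N * (a / (1 - r)) / (real N - a)^2) * T N \<le> (a - real N * b / (real N - a)^2) * T N"
    using TN0 by (intro mult_right_mono) auto
  also have "\<dots> \<le> (\<Sum>j=1..N. S j * T (N - j))" by (rule R(2)[OF N])
  finally show "(a - real N * (a / (1 - r)) / (real N - a)^2) * T N \<le> (\<Sum>j=1..N. S j * T (N - j))" .
qed

section \<open>Canonical partition functions\<close>

lemma has_sum_finite_sum:
  fixes f :: "'i \<Rightarrow> 'a \<Rightarrow> 'b :: topological_comm_monoid_add"
  assumes "\<And>i. i \<in> I \<Longrightarrow> (f i has_sum s i) A"
  shows "((\<lambda>x. \<Sum>i\<in>I. f i x) has_sum (\<Sum>i\<in>I. s i)) A"
  using assms by (induction I rule: infinite_finite_induct) (auto intro!: has_sum_add)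

lemma has_sum_nonneg_product:
  fixes f :: "'a \<Rightarrow> real" and g :: "'b \<Rightarrow> real"
  assumes f: "(f has_sum a) A" and g: "(g has_sum b) B"
    and "\<And>x. x \<in> A \<Longrightarrow> f x \<ge> 0" "\<And>y. y \<in> B \<Longrightarrow> g y \<ge> 0"
  shows "((\<lambda>(x, y). f x * g y) has_sum (a * b)) (A \<times> B)"
proof -
  have 1: "((\<lambda>y. (\<lambda>(x, y). f x * g y) (x, y)) has_sum (f x * b)) B" for x
    using has_sum_cmult_right[OF g, of "f x"] by simp
  have 2: "((\<lambda>x. f x * b) has_sum (a * b)) A"
    using has_sum_cmult_left[OF f, of b] by simp
  show ?thesis
    by (rule has_sum_SigmaI[OF 1 2], rule summable_on_SigmaI[OF 1 has_sum_imp_summable[OF 2]])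
       (use assms in auto)
qed

section \<open>Configurations and the effect of adding particles to one mode\<close>

lemma energy_superset:
  assumes "finite F" "{k. m k \<noteq> 0} \<subseteq> F"
  shows "energy e m = (\<Sum>k\<in>F. real (m k) * e k)"
  unfolding energy_def using assms by (intro sum.mono_neutral_left) auto

lemma configs_iff:
  assumes "finite F" "{k. m k \<noteq> 0} \<subseteq> F"
  shows "m \<in> configs N \<longleftrightarrow> {k. m k \<noteq> 0} \<subseteq> modes \<and> (\<Sum>k\<in>F. m k) = N"
proof -
  have "(\<Sum>k\<in>{k. m k \<noteq> 0}. m k) = (\<Sum>k\<in>F. m k)"
    using assms by (intro sum.mono_neutral_left) auto
  then show ?thesis using assms finite_subset[OF assms(2,1)] by (auto simp: configs_def)
qed

lemma configs_finite_support: "m \<in> configs N \<Longrightarrow> finite {k. m k \<noteq> 0}"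
  by (simp add: configs_def)

lemma configs_occupation_le:
  assumes "m \<in> configs N"
  shows "m k \<le> N"
proof (cases "m k = 0")
  case False
  then have "m k \<le> (\<Sum>k\<in>{k. m k \<noteq> 0}. m k)"
    using assms by (intro member_le_sum) (auto simp: configs_def)
  then show ?thesis using assms by (simp add: configs_def)
qed auto

lemma energy_add_particles:
  assumes "finite {k. m k \<noteq> 0}"
  shows "energy e (m(k := m k + j)) = energy e m + real j * e k"
proof -
  let ?F = "insert k {k. m k \<noteq> 0}"
  have "energy e (m(k := m k + j)) = (\<Sum>l\<in>?F. real ((m(k := m k + j)) l) * e l)"
    using assms by (intro energy_superset) auto
  also have "\<dots> = (\<Sum>l\<in>?F. real (m l) * e l + (if l = k then real j * e k else 0))"
    by (intro sum.cong) (auto simp: algebra_simps)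
  also have "\<dots> = (\<Sum>l\<in>?F. real (m l) * e l) + real j * e k"
    using assms by (simp only: sum.distrib) simp
  also have "(\<Sum>l\<in>?F. real (m l) * e l) = energy e m"
    using assms by (intro energy_superset[symmetric]) auto
  finally show ?thesis .
qed

lemma configs_add_particles_iff:
  assumes "k \<in> modes" "finite {k. m k \<noteq> 0}"
  shows "m(k := m k + j) \<in> configs (N + j) \<longleftrightarrow> m \<in> configs N"
proof -
  let ?F = "insert k {k. m k \<noteq> 0}"
  have "(\<Sum>l\<in>?F. (m(k := m k + j)) l) = (\<Sum>l\<in>?F. m l + (if l = k then j else 0))"
    by (intro sum.cong) auto
  also have "\<dots> = (\<Sum>l\<in>?F. m l) + j" using assms by (simp only: sum.distrib) simp
  finally have eq: "(\<Sum>l\<in>?F. (m(k := m k + j)) l) = (\<Sum>l\<in>?F. m l) + j" .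
  have "m(k := m k + j) \<in> configs (N + j) \<longleftrightarrow>
      {l. (m(k := m k + j)) l \<noteq> 0} \<subseteq> modes \<and> (\<Sum>l\<in>?F. (m(k := m k + j)) l) = N + j"
    using assms by (intro configs_iff) auto
  also have "\<dots> \<longleftrightarrow> {l. m l \<noteq> 0} \<subseteq> modes \<and> (\<Sum>l\<in>?F. m l) = N"
    unfolding eq using assms by auto
  also have "\<dots> \<longleftrightarrow> m \<in> configs N"
    using assms by (intro configs_iff[symmetric]) auto
  finally show ?thesis .
qed

text \<open>Configurations with at least \<open>j\<close> particles in mode \<open>k\<close> are
  those of \<open>N - j\<close> particles with \<open>j\<close> more placed in \<open>k\<close>.
  Since the energy then grows by \<open>j * e k\<close>, tails of occupation numbers reduce to
  smaller partition functions.\<close>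

lemma bij_betw_add_particles:
  assumes k: "k \<in> modes" and j: "j \<le> N"
  shows "bij_betw (\<lambda>m. m(k := m k + j)) (configs (N - j)) {m \<in> configs N. j \<le> m k}"
proof (rule bij_betwI[where g = "\<lambda>m. m(k := m k - j)"])
  show "(\<lambda>m. m(k := m k + j)) \<in> configs (N - j) \<rightarrow> {m \<in> configs N. j \<le> m k}"
  proof
    fix m assume "m \<in> configs (N - j)"
    then show "m(k := m k + j) \<in> {m \<in> configs N. j \<le> m k}"
      using configs_add_particles_iff[OF k configs_finite_support, of m "N - j" j "N - j"] j by simp
  qed
  show "(\<lambda>m. m(k := m k - j)) \<in> {m \<in> configs N. j \<le> m k} \<rightarrow> configs (N - j)"
  proof
    fix m assume m: "m \<in> {m \<in> configs N. j \<le> m k}"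
    let ?m = "m(k := m k - j)"
    have "finite {l. ?m l \<noteq> 0}"
      by (rule finite_subset[of _ "{l. m l \<noteq> 0}"]) (use m configs_finite_support in auto)
    moreover have "?m(k := ?m k + j) = m" using m by auto
    ultimately show "?m \<in> configs (N - j)"
      using configs_add_particles_iff[OF k, of ?m j "N - j"] m j by simp
  qed
qed auto

lemma configs_0: "configs 0 = {\<lambda>_. 0}"
  by (auto simp: configs_def)

text \<open>Induction on \<open>N\<close>: taking one particle out of an occupied mode injects the
  configurations of \<open>Suc N\<close> particles into pairs of a mode and a configuration of
  \<open>N\<close> particles, and the Boltzmann weight becomes a product over the pair.\<close>

lemma boltzmann_summable_on_configs:
  assumes x: "(\<lambda>k. exp (- \<beta> * e k)) summable_on modes"
  shows "(\<lambda>m. exp (- \<beta> * energy e m)) summable_on configs N"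
proof (induction N)
  case 0
  then show ?case by (simp add: configs_0)
next
  case (Suc N)
  \<comment> \<open>Any fixed choice of an occupied mode will do; recording it in the first
    component of \<open>\<phi>\<close> makes the removal reversible.\<close>
  define K where "K = (\<lambda>m :: mode \<Rightarrow> nat. SOME k. m k \<noteq> 0)"
  define \<phi> where "\<phi> = (\<lambda>m :: mode \<Rightarrow> nat. (K m, m(K m := m (K m) - 1)))"
  have K: "m (K m) \<noteq> 0" "K m \<in> modes" if "m \<in> configs (Suc N)" for m
  proof -
    have "(\<Sum>k\<in>{k. m k \<noteq> 0}. m k) \<noteq> 0" using that by (simp add: configs_def)
    then have "{k. m k \<noteq> 0} \<noteq> {}" by (metis sum.empty)
    then have "\<exists>k. m k \<noteq> 0" by blast
    then show *: "m (K m) \<noteq> 0" unfolding K_def by (rule someI_ex)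
    show "K m \<in> modes" using * that by (auto simp: configs_def)
  qed
  have recover: "m = (snd (\<phi> m))(fst (\<phi> m) := snd (\<phi> m) (fst (\<phi> m)) + 1)" if "m \<in> configs (Suc N)" for m
    using K[OF that] by (auto simp: \<phi>_def)
  have inj: "inj_on \<phi> (configs (Suc N))"
    using recover by (intro inj_onI) metis
  have mem: "snd (\<phi> m) \<in> configs N" if m: "m \<in> configs (Suc N)" for m
  proof -
    have "m \<in> {m' \<in> configs (Suc N). 1 \<le> m' (K m)}" using m K(1)[OF m] by auto
    then obtain m' where m': "m' \<in> configs N" "m = m'(K m := m' (K m) + 1)"
      using bij_betw_imp_surj_on[OF bij_betw_add_particles[OF K(2)[OF m], of 1 "Suc N"]] by auto
    have "m (K m) = m' (K m) + 1" using fun_cong[OF m'(2), of "K m"] by simp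
    then have "m(K m := m (K m) - 1) = m'" by (subst (1) m'(2)) auto
    then show ?thesis using m'(1) by (simp add: \<phi>_def)
  qed
  define g where "g = (\<lambda>(k, m). exp (- \<beta> * e k) * exp (- \<beta> * energy e m))"
  have "(g has_sum (infsum (\<lambda>k. exp (- \<beta> * e k)) modes
      * infsum (\<lambda>m. exp (- \<beta> * energy e m)) (configs N))) (modes \<times> configs N)"
    unfolding g_def by (rule has_sum_nonneg_product) (use x Suc in auto)
  then have "g summable_on \<phi> ` configs (Suc N)"
    by (rule summable_on_subset_banach[OF has_sum_imp_summable])
       (use K mem in \<open>auto simp: \<phi>_def\<close>)
  then have "(g \<circ> \<phi>) summable_on configs (Suc N)"
    by (simp add: summable_on_reindex[OF inj])
  moreover have "(g \<circ> \<phi>) m = exp (- \<beta> * energy e m)" if "m \<in> configs (Suc N)" for m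
  proof -
    have "energy e m = energy e (snd (\<phi> m)) + e (fst (\<phi> m))"
      using energy_add_particles[OF configs_finite_support[OF mem[OF that]], of e "fst (\<phi> m)" 1]
        recover[OF that] by simp
    then show ?thesis by (simp add: g_def case_prod_unfold exp_add[symmetric] algebra_simps)
  qed
  ultimately show ?case by (simp cong: summable_on_cong)
qed

section \<open>Partition functions and mean occupation numbers\<close>

lemma Zcan_has_sum:
  assumes "(\<lambda>k. exp (- \<beta> * e k)) summable_on modes"
  shows "((\<lambda>m. exp (- \<beta> * energy e m)) has_sum Zcan \<beta> e N) (configs N)"
  unfolding Zcan_def using boltzmann_summable_on_configs[OF assms] by (rule has_sum_infsum)

lemma Zcan_0: "Zcan \<beta> e 0 = 1"
  by (simp add: Zcan_def configs_0 energy_def)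

lemma occupation_tail_has_sum:
  assumes x: "(\<lambda>k. exp (- \<beta> * e k)) summable_on modes" and n: "n \<in> modes" and j: "j \<le> N"
  shows "((\<lambda>m. if j \<le> m n then exp (- \<beta> * energy e m) else 0) has_sum
           (exp (- \<beta> * e n) ^ j * Zcan \<beta> e (N - j))) (configs N)"
proof -
  have "((\<lambda>m. exp (- \<beta> * e n) ^ j * exp (- \<beta> * energy e m)) has_sum
      (exp (- \<beta> * e n) ^ j * Zcan \<beta> e (N - j))) (configs (N - j))"
    by (intro has_sum_cmult_right Zcan_has_sum x)
  also have "?this \<longleftrightarrow> ((\<lambda>m. exp (- \<beta> * energy e (m(n := m n + j)))) has_sum
      (exp (- \<beta> * e n) ^ j * Zcan \<beta> e (N - j))) (configs (N - j))"
    by (intro has_sum_cong, subst energy_add_particles, erule configs_finite_support)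
       (simp add: exp_of_nat_mult[symmetric] exp_add[symmetric] algebra_simps)
  also have "\<dots> \<longleftrightarrow> ((\<lambda>m. exp (- \<beta> * energy e m)) has_sum
      (exp (- \<beta> * e n) ^ j * Zcan \<beta> e (N - j))) {m \<in> configs N. j \<le> m n}"
    by (rule has_sum_reindex_bij_betw[OF bij_betw_add_particles[OF n j]])
  also have "\<dots> \<longleftrightarrow> ?thesis"
    by (rule has_sum_cong_neutral) auto
  finally show ?thesis .
qed

text \<open>Layer-cake summation: \<open>m n\<close> counts the \<open>j\<close> in
  \<open>{1..N}\<close> with \<open>j \<le> m n\<close>, so the tails add up to the first
  moment.\<close>

lemma occupation_has_sum:
  assumes x: "(\<lambda>k. exp (- \<beta> * e k)) summable_on modes" and n: "n \<in> modes"
  shows "((\<lambda>m. real (m n) * exp (- \<beta> * energy e m)) has_sum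
           (\<Sum>j=1..N. exp (- \<beta> * e n) ^ j * Zcan \<beta> e (N - j))) (configs N)"
proof -
  have "((\<lambda>m. \<Sum>j=1..N. if j \<le> m n then exp (- \<beta> * energy e m) else 0) has_sum
           (\<Sum>j=1..N. exp (- \<beta> * e n) ^ j * Zcan \<beta> e (N - j))) (configs N)"
    by (intro has_sum_finite_sum occupation_tail_has_sum[OF x n]) auto
  also have "?this \<longleftrightarrow> ?thesis"
  proof (rule has_sum_cong)
    fix m assume m: "m \<in> configs N"
    have "{j \<in> {1..N}. j \<le> m n} = {1..m n}" using configs_occupation_le[OF m, of n] by auto
    then show "(\<Sum>j=1..N. if j \<le> m n then exp (- \<beta> * energy e m) else 0)
        = real (m n) * exp (- \<beta> * energy e m)"
      by (simp add: sum.inter_filter[symmetric])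
  qed
  finally show ?thesis .
qed

text \<open>Configurations with mode \<open>n\<close> occupied form only part of all configurations.
  For a mode of energy zero this makes the partition function increase with the particle
  number.\<close>

lemma Zcan_Suc_ge:
  assumes x: "(\<lambda>k. exp (- \<beta> * e k)) summable_on modes" and n: "n \<in> modes"
  shows "exp (- \<beta> * e n) * Zcan \<beta> e N \<le> Zcan \<beta> e (Suc N)"
  using has_sum_mono[OF occupation_tail_has_sum[OF x n, of 1 "Suc N"] Zcan_has_sum[OF x, of "Suc N"]]
  by simp

lemma Zcan_pos:
  assumes "(\<lambda>k. exp (- \<beta> * e k)) summable_on modes"
  shows "Zcan \<beta> e N > 0"
proof (induction N)
  case (Suc N)
  have "0 < exp (- \<beta> * e (1, 1, 1)) * Zcan \<beta> e N" using Suc by simp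
  also have "\<dots> \<le> Zcan \<beta> e (Suc N)" by (rule Zcan_Suc_ge[OF assms]) (simp add: modes_def)
  finally show ?case .
qed (simp add: Zcan_0)

text \<open>Every configuration of \<open>N\<close> particles has \<open>N = (\<Sum>k. m k)\<close>; summing \<open>occupation_has_sum\<close>
  over the modes therefore gives a recursion for the partition functions.\<close>
lemma Zcan_recursion:
  assumes x: "(\<lambda>k. exp (- \<beta> * e k)) summable_on modes"
    and P: "\<And>j. j \<ge> 1 \<Longrightarrow> ((\<lambda>k. exp (- \<beta> * e k) ^ j) has_sum P j) modes"
  shows "real N * Zcan \<beta> e N = (\<Sum>j=1..N. P j * Zcan \<beta> e (N - j))"
proof -
  define f where "f = (\<lambda>(m :: mode \<Rightarrow> nat, k). real (m k) * exp (- \<beta> * energy e m))"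
  have 1: "((\<lambda>k. f (m, k)) has_sum (real N * exp (- \<beta> * energy e m))) modes"
    if m: "m \<in> configs N" for m
  proof -
    have "((\<lambda>k. real (m k)) has_sum real N) {k. m k \<noteq> 0}"
      using m by (intro has_sum_finiteI) (auto simp: configs_def)
    then have "((\<lambda>k. real (m k)) has_sum real N) modes"
      by (rule has_sum_cong_neutral[THEN iffD1, rotated -1]) (use m in \<open>auto simp: configs_def\<close>)
    then show ?thesis unfolding f_def by (simp add: has_sum_cmult_left)
  qed
  have 2: "((\<lambda>m. real N * exp (- \<beta> * energy e m)) has_sum (real N * Zcan \<beta> e N)) (configs N)"
    by (intro has_sum_cmult_right Zcan_has_sum x)
  \<comment> \<open>The terms of \<open>f\<close> are nonnegative, so the double series may be
    summed in either order: first over modes it gives \<open>N\<close> times the partition function,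
    first over configurations it gives the occupation sums.\<close>
  have "(f has_sum (real N * Zcan \<beta> e N)) (configs N \<times> modes)"
    by (rule has_sum_SigmaI[OF 1 2], assumption, rule summable_on_SigmaI[OF 1 has_sum_imp_summable[OF 2]])
       (auto simp: f_def)
  then have "((\<lambda>(k, m). f (m, k)) has_sum (real N * Zcan \<beta> e N)) (modes \<times> configs N)"
    by (simp add: has_sum_swap[of f])
  then have "((\<lambda>k. \<Sum>j=1..N. exp (- \<beta> * e k) ^ j * Zcan \<beta> e (N - j)) has_sum (real N * Zcan \<beta> e N)) modes"
    by (rule has_sum_SigmaD) (use occupation_has_sum[OF x] in \<open>auto simp: f_def\<close>)
  moreover have "((\<lambda>k. \<Sum>j=1..N. exp (- \<beta> * e k) ^ j * Zcan \<beta> e (N - j)) has_sum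
      (\<Sum>j=1..N. P j * Zcan \<beta> e (N - j))) modes"
    by (intro has_sum_finite_sum has_sum_cmult_left P) auto
  ultimately show ?thesis by (rule has_sum_unique)
qed

text \<open>At fixed particle number all energies move by the same \<open>c * N\<close>, so the
  resulting factor cancels in the quotient. This permits measuring energies from the ground
  state.\<close>

lemma occ_can_shift: "occ_can \<beta> (\<lambda>k. e k - c) N n = occ_can \<beta> e N n"
proof -
  have en: "exp (- \<beta> * energy (\<lambda>k. e k - c) m) = exp (\<beta> * c * real N) * exp (- \<beta> * energy e m)"
    if "m \<in> configs N" for m
  proof -
    have "energy (\<lambda>k. e k - c) m = energy e m - c * real N"
    proof -
      have "real N = (\<Sum>k\<in>{k. m k \<noteq> 0}. real (m k))" using that by (auto simp: configs_def)
      then show ?thesis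
        by (simp add: energy_def sum_subtractf sum_distrib_left algebra_simps)
    qed
    then show ?thesis by (simp only: exp_add[symmetric]) (simp add: right_diff_distrib)
  qed
  have 1: "Zcan \<beta> (\<lambda>k. e k - c) N = exp (\<beta> * c * real N) * Zcan \<beta> e N"
    unfolding Zcan_def by (subst infsum_cmult_right'[symmetric], rule infsum_cong, rule en)
  have 2: "infsum (\<lambda>m. real (m n) * exp (- \<beta> * energy (\<lambda>k. e k - c) m)) (configs N)
     = exp (\<beta> * c * real N) * infsum (\<lambda>m. real (m n) * exp (- \<beta> * energy e m)) (configs N)"
    by (subst infsum_cmult_right'[symmetric], rule infsum_cong, subst en) simp_all
  show ?thesis unfolding occ_can_def 1 2 by simp
qed

lemma occ_can_eq:
  assumes x: "(\<lambda>k. exp (- \<beta> * e k)) summable_on modes" and n: "n \<in> modes"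
  shows "occ_can \<beta> e N n = (\<Sum>j=1..N. exp (- \<beta> * e n) ^ j * Zcan \<beta> e (N - j)) / Zcan \<beta> e N"
  unfolding occ_can_def using infsumI[OF occupation_has_sum[OF x n]] by simp

text \<open>Mode \<open>g\<close> has Boltzmann factor 1, which is the 1 split off in
  \<open>1 + S j\<close>; its occupation is \<open>N\<close> minus the mean number of excited
  particles, controlled by \<open>partial_renewal_bounds\<close>. For another mode, monotonicity of
  the partition function leaves a geometric series of ratio \<open>r\<close>.\<close>

lemma occ_can_bounds:
  assumes x: "(\<lambda>k. exp (- \<beta> * e k)) summable_on modes"
    and g: "g \<in> modes" "e g = 0" and r: "0 \<le> r" "r < 1"
    and gap: "\<And>k. k \<in> modes \<Longrightarrow> k \<noteq> g \<Longrightarrow> exp (- \<beta> * e k) \<le> r"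
    and S: "\<And>j. j \<ge> 1 \<Longrightarrow> ((\<lambda>k. exp (- \<beta> * e k) ^ j) has_sum (1 + S j)) modes"
    and a: "(\<lambda>j. S (Suc j)) sums a"
  shows "real N - a \<le> occ_can \<beta> e N g"
    and "real N > a \<Longrightarrow> occ_can \<beta> e N g \<le> real N - a + real N * (a / (1 - r)) / (real N - a)^2"
    and "k \<in> modes \<Longrightarrow> k \<noteq> g \<Longrightarrow> 0 \<le> occ_can \<beta> e N k \<and> occ_can \<beta> e N k \<le> 1 / (1 - r)"
proof -
  define T where "T = Zcan \<beta> e"
  define S' where "S' = (\<lambda>j. if j = 0 then 0 else S j)"
  have T0: "T N > 0" for N unfolding T_def by (rule Zcan_pos[OF x])
  have T: "incseq T"
    unfolding incseq_Suc_iff T_def using Zcan_Suc_ge[OF x g(1)] g(2) by simp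
  have S1: "((\<lambda>k. exp (- \<beta> * e k) ^ j) has_sum S' j) (modes - {g})" if "j \<ge> 1" for j
  proof -
    have "((\<lambda>k. exp (- \<beta> * e k) ^ j) has_sum (1 + S j - (\<Sum>k\<in>{g}. exp (- \<beta> * e k) ^ j))) (modes - {g})"
      by (rule has_sum_Diff[OF S[OF that] has_sum_finiteI]) (use g in auto)
    then show ?thesis using g that by (simp add: S'_def)
  qed
  have nn: "S' j \<ge> 0" for j
  proof (cases "j = 0")
    case False
    then show ?thesis using has_sum_nonneg[OF S1[of j]] by simp
  qed (simp add: S'_def)
  have ratio: "S' (Suc j) \<le> r * S' j" if "j \<ge> 1" for j
  proof (rule has_sum_mono[OF S1 has_sum_cmult_right[OF S1]])
    fix k assume "k \<in> modes - {g}"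
    then show "exp (- \<beta> * e k) ^ Suc j \<le> r * exp (- \<beta> * e k) ^ j"
      using gap[of k] by (simp add: mult_right_mono)
  qed (use that in auto)
  have a': "(\<lambda>j. S' (Suc j)) sums a" using a by (simp add: S'_def)
  have rec: "real N * T N = (\<Sum>j=1..N. (1 + S' j) * T (N - j))" for N
    unfolding T_def by (rule Zcan_recursion[OF x]) (use S in \<open>auto simp: S'_def\<close>)
  note R = partial_renewal_bounds[where T = T and S = S', OF T0 T nn a' r(2,1) ratio rec, of N]
  have occ_g: "occ_can \<beta> e N g = real N - (\<Sum>j=1..N. S' j * T (N - j)) / T N"
  proof -
    have "(\<Sum>j=1..N. T (N - j)) = real N * T N - (\<Sum>j=1..N. S' j * T (N - j))"
      by (simp add: rec sum.distrib algebra_simps)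
    then show ?thesis
      using T0[of N] by (simp add: occ_can_eq[OF x g(1)] g(2) T_def[symmetric] diff_divide_distrib)
  qed
  show "real N - a \<le> occ_can \<beta> e N g"
    unfolding occ_g using R(1) T0[of N] by (simp add: field_simps)
  show "occ_can \<beta> e N g \<le> real N - a + real N * (a / (1 - r)) / (real N - a)^2" if "real N > a"
  proof -
    have "a - real N * (a / (1 - r)) / (real N - a)^2 \<le> (\<Sum>j=1..N. S' j * T (N - j)) / T N"
      using R(2)[OF _ that] T0[of N] by (simp add: pos_le_divide_eq)
    then show ?thesis unfolding occ_g by simp
  qed
  assume k: "k \<in> modes" "k \<noteq> g"
  have "(\<Sum>j=1..N. exp (- \<beta> * e k) ^ j * T (N - j)) \<le> (\<Sum>j=1..N. r ^ j * T N)"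
    using gap[OF k] T0 r incseqD[OF T]
    by (intro sum_mono mult_mono power_mono) (auto simp: less_imp_le)
  also have "\<dots> \<le> 1 / (1 - r) * T N"
  proof -
    have "(\<Sum>j=1..N. r ^ j) \<le> (\<Sum>j. r ^ j)"
      using r by (intro sum_le_suminf) (auto simp: summable_geometric)
    also have "\<dots> = 1 / (1 - r)" using r by (intro suminf_geometric) auto
    finally show ?thesis using T0[of N] by (simp add: sum_distrib_right[symmetric] mult_right_mono del: times_divide_eq_left)
  qed
  finally have "(\<Sum>j=1..N. exp (- \<beta> * e k) ^ j * T (N - j)) / T N \<le> 1 / (1 - r)"
    using T0[of N] by (simp add: pos_divide_le_eq)
  then show "0 \<le> occ_can \<beta> e N k \<and> occ_can \<beta> e N k \<le> 1 / (1 - r)"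
    unfolding occ_can_eq[OF x k(1)] T_def[symmetric]
    using T0 by (auto intro!: divide_nonneg_pos sum_nonneg mult_nonneg_nonneg simp: less_imp_le)
qed

section \<open>Theta sums and the critical density\<close>

lemma gaussian_half_line:
  fixes t :: real
  assumes t: "t > 0"
  shows "has_bochner_integral lborel (\<lambda>x. indicator {0..} x *\<^sub>R exp (- t * x\<^sup>2)) (sqrt pi / (2 * sqrt t))"
proof -
  have "has_bochner_integral lborel (\<lambda>x. indicator {0..} (0 + sqrt t * x) *\<^sub>R exp (- (0 + sqrt t * x)\<^sup>2))
      ((sqrt pi / 2) /\<^sub>R \<bar>sqrt t\<bar>)"
    using gaussian_moment_0 t by (subst lborel_has_bochner_integral_real_affine_iff[symmetric]) auto
  moreover have "indicator {0..} (0 + sqrt t * x) = (indicator {0..} x :: real)" for x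
    using t by (auto simp: indicator_def zero_le_mult_iff)
  ultimately show ?thesis
    using t by (simp add: power_mult_distrib field_simps)
qed

text \<open>Integral test for a decreasing function: the integral lies between the sum started at 1
  and the sum started at 0, and these differ by the value 1 at the origin.\<close>

lemma gaussian_sum_bounds:
  fixes t :: real
  assumes t: "t > 0"
  shows "summable (\<lambda>n. exp (- t * real (Suc n)^2))"
    and "(\<Sum>n. exp (- t * real (Suc n)^2)) \<le> sqrt pi / (2 * sqrt t)"
    and "sqrt pi / (2 * sqrt t) - 1 \<le> (\<Sum>n. exp (- t * real (Suc n)^2))"
proof -
  define f where "f = (\<lambda>x::real. exp (- t * x^2))"
  interpret antimono_fun_sum_integral_diff f
    by unfold_locales (use t in \<open>auto simp: f_def intro!: continuous_intros power_mono\<close>)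
  have int: "set_integrable lborel {0..} f" and I: "(LINT x:{0..}|lborel. f x) = sqrt pi / (2 * sqrt t)"
    using gaussian_half_line[OF t]
    by (auto simp: has_bochner_integral_iff set_integrable_def set_lebesgue_integral_def f_def)
  have "((\<lambda>b. LINT x:{0..b}|lborel. f x) \<longlongrightarrow> (LINT x:{0..}|lborel. f x)) at_top"
    by (rule tendsto_set_lebesgue_integral_at_top[OF _ int]) auto
  moreover have "(LINT x:{0..b}|lborel. f x) = integral {0..b} f" for b
    by (rule set_borel_integral_eq_integral(2), rule set_integrable_subset[OF int]) auto
  ultimately have lim: "((\<lambda>b. integral {0..b} f) \<longlongrightarrow> sqrt pi / (2 * sqrt t)) at_top"
    by (simp add: I)
  have lim: "(\<lambda>n. integral {0..real n} f) \<longlonglongrightarrow> sqrt pi / (2 * sqrt t)"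
    by (rule filterlim_compose[OF lim filterlim_real_sequentially])
  have "convergent (\<lambda>n. integral {0..real n} f)" using lim by (auto simp: convergent_def)
  then have sm: "summable (\<lambda>n. f (real n))" using integral_test by simp
  then show sm': "summable (\<lambda>n. exp (- t * real (Suc n)^2))"
    by (subst (asm) summable_Suc_iff[symmetric]) (simp add: f_def)
  have lim2: "(\<lambda>n. \<Sum>k\<le>n. f (real k)) \<longlonglongrightarrow> (\<Sum>n. f (real n))"
    using sm by (rule summable_LIMSEQ')
  have split: "(\<Sum>n. f (real n)) = (\<Sum>n. exp (- t * real (Suc n)^2)) + 1"
    using suminf_split_head[OF sm] by (simp add: f_def)
  have 1: "(\<Sum>k\<le>n. f (real k)) \<le> integral {0..real n} f + 1" for n
    using sum_integral_diff_series_antimono[of 0 n]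
    by (simp add: sum_integral_diff_series_def) (simp add: f_def)
  have 2: "integral {0..real n} f \<le> (\<Sum>k\<le>n. f (real k))" for n
    using sum_integral_diff_series_nonneg[of n] by (simp add: sum_integral_diff_series_def)
  have "(\<Sum>n. f (real n)) \<le> sqrt pi / (2 * sqrt t) + 1"
    by (rule LIMSEQ_le[OF lim2 tendsto_add[OF lim tendsto_const]]) (use 1 in auto)
  then show "(\<Sum>n. exp (- t * real (Suc n)^2)) \<le> sqrt pi / (2 * sqrt t)" using split by simp
  have "sqrt pi / (2 * sqrt t) \<le> (\<Sum>n. f (real n))"
    by (rule LIMSEQ_le[OF lim lim2]) (use 2 in auto)
  then show "sqrt pi / (2 * sqrt t) - 1 \<le> (\<Sum>n. exp (- t * real (Suc n)^2))" using split by simp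
qed

text \<open>The Dirichlet sum along one axis, measured from its lowest level so that the leading
  term is 1. Up to the factor \<open>exp t\<close> it is half of the Jacobi theta series without its
  central term.\<close>

definition theta :: "real \<Rightarrow> real" where
  "theta t = (\<Sum>n. exp (- t * (real (Suc n)^2 - 1)))"

lemma theta_term_eq: "exp (- t * (real (Suc n)^2 - 1)) = exp t * exp (- t * real (Suc n)^2)"
  by (simp add: exp_add[symmetric] algebra_simps)

lemma theta_sums:
  assumes "t > 0"
  shows "(\<lambda>n. exp (- t * (real (Suc n)^2 - 1))) sums theta t"
  unfolding theta_def theta_term_eq
  by (intro summable_sums summable_mult gaussian_sum_bounds(1) assms)

lemma theta_eq_gaussian_sum:
  assumes "t > 0"
  shows "theta t = exp t * (\<Sum>n. exp (- t * real (Suc n)^2))"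
  unfolding theta_def theta_term_eq by (rule suminf_mult[OF gaussian_sum_bounds(1)[OF assms]])

lemma theta_has_sum:
  assumes "t > 0"
  shows "((\<lambda>n. exp (- t * (real n^2 - 1))) has_sum theta t) {1..}"
proof -
  have "((\<lambda>n. exp (- t * (real (Suc n)^2 - 1))) has_sum theta t) UNIV"
    by (rule sums_nonneg_imp_has_sum[OF theta_sums[OF assms]]) simp
  moreover have "bij_betw Suc UNIV {1..}"
    by (rule bij_betwI[where g = "\<lambda>n. n - 1"]) auto
  ultimately show ?thesis
    using has_sum_reindex_bij_betw[of Suc UNIV "{1..}" "\<lambda>n. exp (- t * (real n^2 - 1))"] by simp
qed

text \<open>The leading term is 1. In the remainder,
  \<open>(n + 2)^2 - 1 \<ge> (n + 1)^2 + 2\<close> for natural \<open>n\<close>, so a factor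
  \<open>exp (- 2 * t)\<close> can be pulled out of a Gaussian sum.\<close>

lemma theta_bounds:
  assumes t: "t > 0"
  shows "1 \<le> theta t" "theta t - 1 \<le> exp (- 2 * t) * (sqrt pi / (2 * sqrt t))"
proof -
  have sm: "summable (\<lambda>n. exp (- t * (real (Suc n)^2 - 1)))"
    using theta_sums[OF t] by (rule sums_summable)
  have eq: "theta t = (\<Sum>n. exp (- t * (real (Suc (Suc n))^2 - 1))) + 1"
    unfolding theta_def using suminf_split_head[OF sm] by simp
  have sm': "summable (\<lambda>n. exp (- t * (real (Suc (Suc n))^2 - 1)))"
    by (rule summable_Suc_iff[THEN iffD2, OF sm])
  show "1 \<le> theta t" unfolding eq using suminf_nonneg[OF sm'] by simp
  have "(\<Sum>n. exp (- t * (real (Suc (Suc n))^2 - 1))) \<le> (\<Sum>n. exp (- 2 * t) * exp (- t * real (Suc n)^2))"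
  proof (rule suminf_le[OF _ sm' summable_mult[OF gaussian_sum_bounds(1)[OF t]]])
    fix n
    have "t * (2 + real (Suc n)^2) \<le> t * (real (Suc (Suc n))^2 - 1)"
      using t by (intro mult_left_mono) (auto simp: power2_eq_square algebra_simps)
    then show "exp (- t * (real (Suc (Suc n))^2 - 1)) \<le> exp (- 2 * t) * exp (- t * real (Suc n)^2)"
      by (simp add: exp_add[symmetric] algebra_simps)
  qed
  also have "\<dots> = exp (- 2 * t) * (\<Sum>n. exp (- t * real (Suc n)^2))"
    by (rule suminf_mult[OF gaussian_sum_bounds(1)[OF t]])
  also have "\<dots> \<le> exp (- 2 * t) * (sqrt pi / (2 * sqrt t))"
    by (intro mult_left_mono gaussian_sum_bounds(2) t) auto
  finally show "theta t - 1 \<le> exp (- 2 * t) * (sqrt pi / (2 * sqrt t))" using eq by simp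
qed

lemma powr_le_exp:
  fixes t q :: real
  assumes "t > 0" "q \<ge> 0"
  shows "t powr q \<le> exp t * (q + 1) powr q"
proof -
  \<comment> \<open>\<open>ln x \<le> x\<close> is applied at \<open>x = t / (q + 1)\<close>;
    dividing by \<open>q + 1\<close> rather than \<open>q\<close> also covers
    \<open>q = 0\<close>.\<close>
  have "q * ln (t / (q + 1)) \<le> q * (t / (q + 1))"
    using assms by (intro mult_left_mono ln_bound) auto
  also have "\<dots> \<le> t" using assms by (simp add: field_simps)
  finally have "q * ln t \<le> t + q * ln (q + 1)" using assms by (simp add: ln_div algebra_simps)
  then have "exp (q * ln t) \<le> exp (t + q * ln (q + 1))" by simp
  then show ?thesis using assms by (simp add: powr_def exp_add)
qed

text \<open>At small \<open>t\<close> the remainder is of order \<open>t powr (-1/2)\<close>, and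
  the exponential factor absorbs any further power. The free exponent \<open>p\<close> later trades
  decay in \<open>j\<close> against growth in \<open>V\<close>.\<close>

lemma theta_powr_bound:
  fixes p :: real
  assumes p: "p \<ge> 1/2"
  obtains C where "C \<ge> 0" "\<And>t. t > 0 \<Longrightarrow> theta t - 1 \<le> C * t powr (- p)"
proof -
  define q where "q = p - 1/2"
  have q: "q \<ge> 0" using p by (simp add: q_def)
  define C where "C = (q + 1) powr q * (sqrt pi / 2)"
  show thesis
  proof (rule that[of C])
    show "C \<ge> 0" by (simp add: C_def)
    fix t :: real assume t: "t > 0"
    have "exp (- 2 * t) \<le> exp (- t)" using t by simp
    also have "\<dots> \<le> (q + 1) powr q * t powr (- q)"
      using powr_le_exp[OF t q] t by (simp add: powr_minus exp_minus field_simps)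
    finally have "exp (- 2 * t) * (sqrt pi / (2 * sqrt t)) \<le> (q + 1) powr q * t powr (- q) * (sqrt pi / (2 * sqrt t))"
      using t by (intro mult_right_mono) auto
    also have "\<dots> = C * (t powr (- q) * t powr (- (1/2)))"
      using t by (simp add: C_def powr_minus powr_half_sqrt field_simps)
    also have "t powr (- q) * t powr (- (1/2)) = t powr (- p)"
      by (simp add: powr_add[symmetric] q_def)
    finally show "theta t - 1 \<le> C * t powr (- p)" using theta_bounds(2)[OF t] by simp
  qed
qed

lemma sqrt_mult_theta_tendsto: "((\<lambda>t. sqrt t * theta t) \<longlongrightarrow> sqrt pi / 2) (at_right 0)"
proof (rule tendsto_sandwich)
  have pos: "eventually (\<lambda>t::real. t > 0) (at_right 0)" by (simp add: eventually_at_right_less)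
  have b: "sqrt pi / 2 - sqrt t \<le> sqrt t * (\<Sum>n. exp (- t * real (Suc n)^2))"
    "sqrt t * (\<Sum>n. exp (- t * real (Suc n)^2)) \<le> sqrt pi / 2" if "t > 0" for t
  proof -
    have "sqrt t * (sqrt pi / (2 * sqrt t)) = sqrt pi / 2"
      "sqrt t * (sqrt pi / (2 * sqrt t) - 1) = sqrt pi / 2 - sqrt t"
      using that by (auto simp: field_simps)
    then show "sqrt pi / 2 - sqrt t \<le> sqrt t * (\<Sum>n. exp (- t * real (Suc n)^2))"
      "sqrt t * (\<Sum>n. exp (- t * real (Suc n)^2)) \<le> sqrt pi / 2"
      using mult_left_mono[OF gaussian_sum_bounds(2)[OF that], of "sqrt t"]
        mult_left_mono[OF gaussian_sum_bounds(3)[OF that], of "sqrt t"] that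
      by auto
  qed
  have eq: "sqrt t * theta t = exp t * (sqrt t * (\<Sum>n. exp (- t * real (Suc n)^2)))" if "t > 0" for t
    using theta_eq_gaussian_sum[OF that] by simp
  show "eventually (\<lambda>t. exp t * (sqrt pi / 2 - sqrt t) \<le> sqrt t * theta t) (at_right 0)"
    using pos by eventually_elim (unfold eq, intro mult_left_mono b, auto)
  show "eventually (\<lambda>t. sqrt t * theta t \<le> exp t * (sqrt pi / 2)) (at_right 0)"
    using pos by eventually_elim (unfold eq, intro mult_left_mono b, auto)
  show "((\<lambda>t. exp t * (sqrt pi / 2 - sqrt t)) \<longlongrightarrow> sqrt pi / 2) (at_right (0::real))"
    by (rule tendsto_eq_intros refl | simp)+
  show "((\<lambda>t. exp t * (sqrt pi / 2)) \<longlongrightarrow> sqrt pi / 2) (at_right (0::real))"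
    by (rule tendsto_eq_intros refl | simp)+
qed

section \<open>The critical density as a series\<close>

lemma sqrt_exp_half_line:
  fixes s :: real
  assumes s: "s > 0"
  shows "has_bochner_integral lborel (\<lambda>x. indicator {0<..} x *\<^sub>R (sqrt x * exp (- s * x)))
           (sqrt pi / 2 * s powr (-3/2))"
proof -
  have G: "Gamma (3/2 :: real) = sqrt pi / 2"
  proof -
    have "(1/2 :: real) \<notin> \<int>\<^sub>\<le>\<^sub>0" by (auto dest: nonpos_Ints_nonpos)
    then show ?thesis using Gamma_plus1[of "1/2 :: real"] by (simp add: Gamma_one_half_real)
  qed
  have "has_bochner_integral lborel (\<lambda>t. indicator {0..} t * t powr (3/2 - 1) / exp t) (Gamma (3/2 :: real))"
    by (rule has_bochner_integral_nn_integral)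
       (auto simp: Gamma_conv_nn_integral_real indicator_def)
  then have "has_bochner_integral lborel
      (\<lambda>t. indicator {0..} (0 + s * t) * (0 + s * t) powr (3/2 - 1) / exp (0 + s * t)) (Gamma (3/2) /\<^sub>R \<bar>s\<bar>)"
    using s by (subst lborel_has_bochner_integral_real_affine_iff[symmetric]) auto
  then have "has_bochner_integral lborel
      (\<lambda>t. s powr (-1/2) * (indicator {0..} (0 + s * t) * (0 + s * t) powr (3/2 - 1) / exp (0 + s * t)))
      (s powr (-1/2) * (Gamma (3/2) /\<^sub>R \<bar>s\<bar>))"
    by (intro has_bochner_integral_mult_right) auto
  also have "(\<lambda>t. s powr (-1/2) * (indicator {0..} (0 + s * t) * (0 + s * t) powr (3/2 - 1) / exp (0 + s * t)))
      = (\<lambda>x. indicator {0<..} x *\<^sub>R (sqrt x * exp (- s * x)))"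
  proof
    fix x :: real
    show "s powr (-1/2) * (indicator {0..} (0 + s * x) * (0 + s * x) powr (3/2 - 1) / exp (0 + s * x))
      = indicator {0<..} x *\<^sub>R (sqrt x * exp (- s * x))"
    proof (cases "x > 0")
      case True
      then have "(s * x) powr (1/2) = s powr (1/2) * sqrt x"
        using s by (simp add: powr_mult powr_half_sqrt)
      moreover have "s powr (-1/2) * s powr (1/2) = 1" using s by (simp add: powr_add[symmetric])
      ultimately show ?thesis using True s by (simp add: exp_minus field_simps)
    next
      case False
      then show ?thesis using s by (auto simp: indicator_def zero_le_mult_iff)
    qed
  qed
  also have "s powr (-1/2) * (Gamma (3/2) /\<^sub>R \<bar>s\<bar>) = sqrt pi / 2 * s powr (-3/2)"
  proof -
    have "s powr (-3/2) = s powr (-1/2) * s powr (-1)" by (subst powr_add[symmetric]) simp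
    then show ?thesis using s by (simp add: G powr_minus field_simps)
  qed
  finally show ?thesis .
qed

text \<open>The Bose factor is expanded into a geometric series in
  \<open>exp (- \<beta> * x)\<close> and integrated term by term, each term being a Gamma integral
  of order 3/2.\<close>

lemma rho_c_sums:
  assumes \<beta>: "\<beta> > 0"
  shows "(\<lambda>j. (2 * pi * \<beta> * real (Suc j)) powr (-3/2)) sums rho_c \<beta>"
proof -
  define K where "K = sqrt 2 / (3 * pi^2) * (3/2)"
  define f where "f = (\<lambda>j (x::real). K * (indicator {0<..} x *\<^sub>R (sqrt x * exp (- (\<beta> * real (Suc j)) * x))))"
  have K: "K \<ge> 0" by (simp add: K_def)
  \<comment> \<open>The constant of \<open>Fdens\<close> times Gamma(3/2) is
    \<open>(2 * pi) powr (-3/2)\<close>.\<close>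
  have val: "K * (sqrt pi / 2 * (\<beta> * real (Suc j)) powr (-3/2)) = (2 * pi * \<beta> * real (Suc j)) powr (-3/2)" for j
  proof -
    have p: "2 powr (-3/2) = sqrt 2 / (4::real)"
    proof -
      have "2 powr (-3/2) = 2 powr (1/2) * 2 powr (-2 :: real)" by (subst powr_add[symmetric]) simp
      also have "\<dots> = sqrt 2 / 4" by (simp add: powr_half_sqrt powr_minus)
      finally show ?thesis .
    qed
    have "pi powr (-3/2) = pi powr (1/2) * pi powr (-2 :: real)" by (subst powr_add[symmetric]) simp
    also have "\<dots> = sqrt pi / pi^2" by (simp add: powr_half_sqrt powr_minus field_simps)
    finally have q: "pi powr (-3/2) = sqrt pi / pi^2" .
    have "(2 * pi * \<beta> * real (Suc j)) powr (-3/2) = 2 powr (-3/2) * pi powr (-3/2) * (\<beta> * real (Suc j)) powr (-3/2)"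
      using \<beta> by (simp add: powr_mult mult.assoc)
    then show ?thesis unfolding p q K_def by simp
  qed
  have int: "has_bochner_integral lborel (f j) ((2 * pi * \<beta> * real (Suc j)) powr (-3/2))" for j
    unfolding f_def val[symmetric] using \<beta>
    by (intro has_bochner_integral_mult_right sqrt_exp_half_line) auto
  have nn: "f j x \<ge> 0" for j x using K by (auto simp: f_def indicator_def)
  have geo: "(\<lambda>j. f j x) sums (indicator {0<..} x *\<^sub>R (1 / (exp (\<beta> * x) - 1) * Fdens x))" for x
  proof (cases "x > 0")
    case True
    define z where "z = exp (- \<beta> * x)"
    have z: "0 < z" "z < 1" using True \<beta> by (auto simp: z_def)
    have "(\<lambda>j. K * sqrt x * z * z ^ j) sums (K * sqrt x * z * (1 / (1 - z)))"
      using z by (intro sums_mult geometric_sums) auto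
    moreover have "K * sqrt x * z * (1 / (1 - z)) = 1 / (exp (\<beta> * x) - 1) * Fdens x"
    proof -
      have "z * (1 / (1 - z)) = 1 / (exp (\<beta> * x) - 1)"
        using z True \<beta> by (simp add: z_def exp_minus field_simps)
      moreover have "Fdens x = K * sqrt x" by (simp add: Fdens_def K_def)
      ultimately show ?thesis by (metis mult.assoc mult.commute)
    qed
    moreover have "exp (- (\<beta> * real (Suc j)) * x) = z * z ^ j" for j
      by (simp add: z_def exp_of_nat_mult[symmetric] exp_add[symmetric] algebra_simps)
    ultimately show ?thesis using True
      by (simp only: f_def) (simp add: mult_ac)
  next
    case False
    then show ?thesis by (simp add: f_def)
  qed
  have sm: "summable (\<lambda>j. (2 * pi * \<beta> * real (Suc j)) powr (-3/2))"
  proof -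
    have "summable (\<lambda>j. (2 * pi * \<beta>) powr (-3/2) * real j powr (-3/2))"
      by (intro summable_mult) (simp add: summable_real_powr_iff)
    then have "summable (\<lambda>j. (2 * pi * \<beta>) powr (-3/2) * real (Suc j) powr (-3/2))"
      by (subst summable_Suc_iff)
    then show ?thesis using \<beta> by (subst powr_mult) auto
  qed
  have "(\<lambda>j. integral\<^sup>L lborel (f j)) sums (\<integral>x. (\<Sum>j. f j x) \<partial>lborel)"
  proof (rule sums_integral)
    show "integrable lborel (f j)" for j using int by (auto simp: has_bochner_integral_iff)
    show "AE x in lborel. summable (\<lambda>j. norm (f j x))"
      using geo nn by (auto simp: sums_iff)
    show "summable (\<lambda>j. \<integral>x. norm (f j x) \<partial>lborel)"
      using sm int nn by (simp add: has_bochner_integral_iff)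
  qed
  then show ?thesis
    using int sums_unique[OF geo]
    by (simp add: has_bochner_integral_iff rho_c_def set_lebesgue_integral_def)
qed

section \<open>The thermodynamic limit\<close>

text \<open>The argument at which \<open>theta\<close> gives the sum, along an axis of exponent
  \<open>a\<close>, of the \<open>j\<close>-th powers of the relative Boltzmann factors.\<close>

definition scaled_energy :: "real \<Rightarrow> real \<Rightarrow> real \<Rightarrow> nat \<Rightarrow> real" where
  "scaled_energy \<beta> V a j = \<beta> * pi^2 / 2 * real j * V powr (-2 * a)"

text \<open>The sum of the \<open>j\<close>-th powers of the Boltzmann factors, relative to the ground state, over all
  excited modes.\<close>
definition excited_sum :: "real \<Rightarrow> real \<Rightarrow> real \<Rightarrow> real \<Rightarrow> real \<Rightarrow> nat \<Rightarrow> real" where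
  "excited_sum \<beta> a1 a2 a3 V j = theta (scaled_energy \<beta> V a1 j)
     * (theta (scaled_energy \<beta> V a2 j) * theta (scaled_energy \<beta> V a3 j)) - 1"

lemma scaled_energy_pos: "\<beta> > 0 \<Longrightarrow> V > 0 \<Longrightarrow> j \<ge> 1 \<Longrightarrow> scaled_energy \<beta> V a j > 0"
  by (simp add: scaled_energy_def)

lemma boltzmann_power_has_sum:
  assumes "\<beta> > 0" "V > 0" "j \<ge> 1"
  shows "((\<lambda>k. exp (- \<beta> * (eps a1 a2 a3 V k - eps a1 a2 a3 V (1, 1, 1))) ^ j) has_sum
     (1 + excited_sum \<beta> a1 a2 a3 V j)) modes"
proof -
  define g where "g = (\<lambda>a n. exp (- scaled_energy \<beta> V a j * (real n ^ 2 - 1)))"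
  have g: "(g a has_sum theta (scaled_energy \<beta> V a j)) {1..}" for a
    unfolding g_def by (rule theta_has_sum[OF scaled_energy_pos[OF assms]])
  have nn: "g a n \<ge> 0" for a n by (simp add: g_def)
  have "((\<lambda>(n1, p). g a1 n1 * (\<lambda>(n2, n3). g a2 n2 * g a3 n3) p) has_sum
     (1 + excited_sum \<beta> a1 a2 a3 V j)) ({1..} \<times> {1..} \<times> {1..})"
  proof -
    have "1 + excited_sum \<beta> a1 a2 a3 V j = theta (scaled_energy \<beta> V a1 j)
       * (theta (scaled_energy \<beta> V a2 j) * theta (scaled_energy \<beta> V a3 j))"
      by (simp add: excited_sum_def)
    then show ?thesis by (simp only:) (intro has_sum_nonneg_product g, auto simp: nn)
  qed
  moreover have "modes = {1..} \<times> {1..} \<times> {1..}" by (auto simp: modes_def)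
  moreover have "(\<lambda>(n1, p). g a1 n1 * (\<lambda>(n2, n3). g a2 n2 * g a3 n3) p)
      = (\<lambda>k. exp (- \<beta> * (eps a1 a2 a3 V k - eps a1 a2 a3 V (1, 1, 1))) ^ j)"
  proof (rule ext, clarify)
    fix n1 n2 n3 :: nat
    show "g a1 n1 * (g a2 n2 * g a3 n3)
        = exp (- \<beta> * (eps a1 a2 a3 V (n1, n2, n3) - eps a1 a2 a3 V (1, 1, 1))) ^ j"
      unfolding g_def exp_of_nat_mult[symmetric] exp_add[symmetric]
      by (rule arg_cong[of _ _ exp]) (simp add: scaled_energy_def eps_def field_simps)
  qed
  ultimately show ?thesis by simp
qed

text \<open>Near zero \<open>theta t\<close> behaves like \<open>sqrt pi / (2 * sqrt t)\<close>;
  with \<open>t = c * V powr (-2 * a)\<close> the prefactor \<open>V powr (- a)\<close> compensates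
  exactly. The constants fit because \<open>2 * pi * \<beta> * j = c * 4 / pi\<close>.\<close>

lemma scaled_theta_tendsto:
  assumes "\<beta> > 0" "a > 0" "j \<ge> 1"
  shows "((\<lambda>V. V powr (- a) * theta (scaled_energy \<beta> V a j)) \<longlongrightarrow>
           (2 * pi * \<beta> * real j) powr (-1/2)) at_top"
proof -
  define c where "c = \<beta> * pi^2 / 2 * real j"
  have c: "c > 0" using assms by (simp add: c_def)
  have lim: "filterlim (\<lambda>V. c * V powr (-2 * a)) (at_right 0) at_top"
    using c assms by real_asymp
  have "((\<lambda>V. sqrt (c * V powr (-2 * a)) * theta (c * V powr (-2 * a)) / sqrt c) \<longlongrightarrow> (sqrt pi / 2) / sqrt c) at_top"
    by (intro tendsto_divide tendsto_const filterlim_compose[OF sqrt_mult_theta_tendsto lim]) (use c in auto)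
  moreover have "eventually (\<lambda>V. sqrt (c * V powr (-2 * a)) * theta (c * V powr (-2 * a)) / sqrt c
      = V powr (- a) * theta (scaled_energy \<beta> V a j)) at_top"
    using eventually_gt_at_top[of "0::real"]
  proof eventually_elim
    case (elim V)
    have "sqrt (V powr (-2 * a)) = V powr (- a)"
      using elim by (simp add: powr_half_sqrt[symmetric] powr_powr)
    moreover have "scaled_energy \<beta> V a j = c * V powr (-2 * a)"
      by (simp add: scaled_energy_def c_def)
    ultimately show ?case using c by (simp add: real_sqrt_mult)
  qed
  moreover have "(sqrt pi / 2) / sqrt c = (2 * pi * \<beta> * real j) powr (-1/2)"
  proof -
    have "2 * pi * \<beta> * real j = c * 4 / pi"
      using assms by (simp add: c_def power2_eq_square)
    moreover have "(c * 4 / pi) powr (-1/2) = 1 / sqrt (c * 4 / pi)"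
      using c by (simp add: powr_minus powr_half_sqrt field_simps)
    ultimately show ?thesis using c by (simp add: real_sqrt_mult real_sqrt_divide)
  qed
  ultimately show ?thesis by (simp add: tendsto_cong)
qed

text \<open>As the exponents add up to 1, the factor \<open>1 / V\<close> distributes over the three
  axes, each contributing a limit of power -1/2; the subtracted ground-state term
  \<open>1 / V\<close> vanishes.\<close>

lemma excited_sum_tendsto:
  assumes "\<beta> > 0" "a1 > 0" "a2 > 0" "a3 > 0" "a1 + a2 + a3 = 1" "j \<ge> 1"
  shows "((\<lambda>V. excited_sum \<beta> a1 a2 a3 V j / V) \<longlongrightarrow> (2 * pi * \<beta> * real j) powr (-3/2)) at_top"
proof -
  let ?h = "\<lambda>a V. V powr (- a) * theta (scaled_energy \<beta> V a j)"
  let ?l = "(2 * pi * \<beta> * real j) powr (-1/2)"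
  have "((\<lambda>V. ?h a1 V * ?h a2 V * ?h a3 V - 1 / V) \<longlongrightarrow> ?l * ?l * ?l - 0) at_top"
    by (intro tendsto_diff tendsto_mult scaled_theta_tendsto assms) real_asymp
  moreover have "?l * ?l * ?l - 0 = (2 * pi * \<beta> * real j) powr (-3/2)"
    by (simp only: powr_add[symmetric] diff_zero) simp
  moreover have "eventually (\<lambda>V. ?h a1 V * ?h a2 V * ?h a3 V - 1 / V = excited_sum \<beta> a1 a2 a3 V j / V) at_top"
    using eventually_gt_at_top[of "0::real"]
  proof eventually_elim
    case (elim V)
    have "V powr (- a1) * V powr (- a2) * V powr (- a3) = V powr (- (a1 + a2 + a3))"
      by (simp add: powr_add[symmetric])
    then have "V powr (- a1) * V powr (- a2) * V powr (- a3) = 1 / V"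
      using elim assms(5) by (simp add: powr_minus_divide)
    moreover have "?h a1 V * ?h a2 V * ?h a3 V = (V powr (- a1) * V powr (- a2) * V powr (- a3)) * (theta (scaled_energy \<beta> V a1 j)
     * (theta (scaled_energy \<beta> V a2 j) * theta (scaled_energy \<beta> V a3 j)))"
      by (simp only: mult_ac)
    ultimately show ?case by (simp add: excited_sum_def diff_divide_distrib)
  qed
  ultimately show ?thesis by (simp add: tendsto_cong)
qed

lemma theta_scaled_bound:
  assumes "p \<ge> 1/2" "\<beta> > 0"
  obtains C where "C \<ge> 0" "\<And>V a j. V > 0 \<Longrightarrow> j \<ge> 1 \<Longrightarrow>
     theta (scaled_energy \<beta> V a j) - 1 \<le> C * real j powr (- p) * V powr (2 * a * p)"
proof -
  obtain C where C: "C \<ge> 0" "\<And>t. t > 0 \<Longrightarrow> theta t - 1 \<le> C * t powr (- p)"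
    using theta_powr_bound[OF assms(1)] by blast
  show thesis
  proof (rule that[of "C * (\<beta> * pi^2 / 2) powr (- p)"])
    show "0 \<le> C * (\<beta> * pi^2 / 2) powr (- p)" using C(1) by simp
    fix V a :: real and j :: nat assume V: "V > 0" and j: "j \<ge> 1"
    have "scaled_energy \<beta> V a j powr (- p)
        = (\<beta> * pi^2 / 2) powr (- p) * real j powr (- p) * (V powr (-2 * a)) powr (- p)"
      unfolding scaled_energy_def using assms(2) j by (simp only: powr_mult)
    also have "(V powr (-2 * a)) powr (- p) = V powr (2 * a * p)" by (simp add: powr_powr)
    finally show "theta (scaled_energy \<beta> V a j) - 1
        \<le> C * (\<beta> * pi^2 / 2) powr (- p) * real j powr (- p) * V powr (2 * a * p)"
      using C(2)[OF scaled_energy_pos[OF assms(2) V j, of a]] by (simp add: mult.assoc)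
  qed
qed

text \<open>Expand the product of the \<open>1 + u i\<close>. Triple products decay like \<open>j powr (-3/2)\<close> and carry
  exactly one power of \<open>V\<close>; in the others a faster decay in \<open>j\<close> is bought with powers of \<open>V\<close>, and
  \<open>a1 < 1/2\<close> ensures that one power of \<open>V\<close> buys an exponent larger than one.\<close>
lemma excited_sum_bound:
  assumes "\<beta> > 0" "a1 \<ge> a2" "a2 \<ge> a3" "a3 > 0" "a1 + a2 + a3 = 1" "a1 < 1/2"
  obtains C where "\<And>V j. V \<ge> 1 \<Longrightarrow> j \<ge> 1 \<Longrightarrow> excited_sum \<beta> a1 a2 a3 V j / V
     \<le> C * (real j powr (-3/2) + real j powr (- (1 / (2 * a1))))"
proof -
  have a1: "a1 > 0" using assms by simp
  \<comment> \<open>\<open>q\<close> is the decay exponent at which a single factor along the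
    longest axis costs exactly one power of \<open>V\<close>. Pairs use \<open>q / 2\<close> per
    factor and triples \<open>1 / 2\<close>, giving the constants \<open>D\<close>, \<open>B\<close>
    and \<open>A\<close>.\<close>
  define q where "q = 1 / (2 * a1)"
  have q: "q \<ge> 1" "q / 2 \<ge> 1/2" using a1 assms by (auto simp: q_def field_simps)
  obtain A where A: "A \<ge> 0" "\<And>V a j. V > 0 \<Longrightarrow> j \<ge> 1 \<Longrightarrow>
     theta (scaled_energy \<beta> V a j) - 1 \<le> A * real j powr (- (1/2)) * V powr (2 * a * (1/2))"
    using theta_scaled_bound[of "1/2"] assms by auto
  obtain B where B: "B \<ge> 0" "\<And>V a j. V > 0 \<Longrightarrow> j \<ge> 1 \<Longrightarrow>
     theta (scaled_energy \<beta> V a j) - 1 \<le> B * real j powr (- (q/2)) * V powr (2 * a * (q/2))"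
    using theta_scaled_bound[OF q(2) assms(1)] by auto
  obtain D where D: "D \<ge> 0" "\<And>V a j. V > 0 \<Longrightarrow> j \<ge> 1 \<Longrightarrow>
     theta (scaled_energy \<beta> V a j) - 1 \<le> D * real j powr (- q) * V powr (2 * a * q)"
    using theta_scaled_bound[of q] q(1) assms by auto
  show thesis
  proof (rule that[of "A * A * A + 3 * (B * B) + 3 * D"])
    fix V :: real and j :: nat assume V: "V \<ge> 1" and j: "j \<ge> 1"
    define u where "u = (\<lambda>a. theta (scaled_energy \<beta> V a j) - 1)"
    let ?x = "real j powr (-3/2)" and ?y = "real j powr (- q)"
    have u0: "u a \<ge> 0" for a
      using theta_bounds(1)[OF scaled_energy_pos[of \<beta> V j a]] assms V j by (simp add: u_def)
    have 3: "u a1 * u a2 * u a3 \<le> A * A * A * ?x * V"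
    proof -
      have "u a1 * u a2 * u a3 \<le> (A * real j powr (- (1/2)) * V powr a1)
          * (A * real j powr (- (1/2)) * V powr a2) * (A * real j powr (- (1/2)) * V powr a3)"
        using A(2)[of V j] V j A(1) by (intro mult_mono u0) (auto simp: u_def u0[unfolded u_def])
      also have "\<dots> = A * A * A * (real j powr (- (1/2)) * real j powr (- (1/2)) * real j powr (- (1/2)))
          * (V powr a1 * V powr a2 * V powr a3)"
        by (simp only: mult_ac)
      also have "V powr a1 * V powr a2 * V powr a3 = V"
        using V assms(5) by (simp add: powr_add[symmetric])
      also have "real j powr (- (1/2)) * real j powr (- (1/2)) * real j powr (- (1/2)) = ?x"
        by (simp only: powr_add[symmetric]) simp
      finally show ?thesis .
    qed
    have u1: "u a \<le> D * ?y * V" if "a \<le> a1" for a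
    proof -
      have "V powr (2 * a * q) \<le> V powr 1"
        using V that a1 by (intro powr_mono) (auto simp: q_def field_simps)
      then have "D * ?y * V powr (2 * a * q) \<le> D * ?y * V"
        using V D(1) by (intro mult_left_mono) auto
      then show ?thesis using D(2)[of V j a] V j by (simp add: u_def)
    qed
    have u2: "u a * u b \<le> B * B * ?y * V" if "a \<le> a1" "b \<le> a1" for a b
    proof -
      have *: "u a \<le> B * real j powr (- (q/2)) * V powr (1/2)" if "a \<le> a1" for a
      proof -
        have "V powr (2 * a * (q/2)) \<le> V powr (1/2)"
          using V that a1 by (intro powr_mono) (auto simp: q_def field_simps)
        then have "B * real j powr (- (q/2)) * V powr (2 * a * (q/2)) \<le> B * real j powr (- (q/2)) * V powr (1/2)"
          using V B(1) by (intro mult_left_mono) auto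
        then show ?thesis using B(2)[of V j a] V j by (simp add: u_def)
      qed
      have "u a * u b \<le> (B * real j powr (- (q/2)) * V powr (1/2)) * (B * real j powr (- (q/2)) * V powr (1/2))"
        using *[OF that(1)] *[OF that(2)] B(1) by (intro mult_mono u0) auto
      also have "\<dots> = B * B * (real j powr (- (q/2)) * real j powr (- (q/2))) * (V powr (1/2) * V powr (1/2))"
        by (simp only: mult_ac)
      also have "V powr (1/2) * V powr (1/2) = V" using V by (simp add: powr_add[symmetric])
      also have "real j powr (- (q/2)) * real j powr (- (q/2)) = ?y" by (simp add: powr_add[symmetric])
      finally show ?thesis .
    qed
    have "excited_sum \<beta> a1 a2 a3 V j = u a1 * u a2 * u a3
        + (u a1 * u a2 + u a1 * u a3 + u a2 * u a3) + (u a1 + u a2 + u a3)"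
      by (simp add: excited_sum_def u_def algebra_simps)
    also have "\<dots> \<le> A * A * A * ?x * V + (B * B * ?y * V + B * B * ?y * V + B * B * ?y * V)
        + (D * ?y * V + D * ?y * V + D * ?y * V)"
      using assms by (intro add_mono 3 u1 u2) auto
    also have "\<dots> = (A * A * A * ?x + (3 * (B * B) + 3 * D) * ?y) * V" by (simp add: algebra_simps)
    also have "\<dots> \<le> ((A * A * A + 3 * (B * B) + 3 * D) * (?x + ?y)) * V"
    proof -
      have "0 \<le> (3 * (B * B) + 3 * D) * ?x" "0 \<le> A * A * A * ?y"
        using A(1) B(1) D(1) by auto
      then show ?thesis using V by (intro mult_right_mono) (auto simp: algebra_simps)
    qed
    finally show "excited_sum \<beta> a1 a2 a3 V j / V
     \<le> (A * A * A + 3 * (B * B) + 3 * D) * (real j powr (-3/2) + real j powr (- (1 / (2 * a1))))"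
      using V by (simp add: pos_divide_le_eq q_def)
  qed
qed

text \<open>Tannery's theorem, with the majorant of \<open>excited_sum_bound\<close>: it is uniform
  in \<open>V \<ge> 1\<close> and summable because both 3/2 and \<open>1 / (2 * a1)\<close> exceed
  1.\<close>

lemma critical_density_limit:
  assumes "\<beta> > 0" "a1 \<ge> a2" "a2 \<ge> a3" "a3 > 0" "a1 + a2 + a3 = 1" "a1 < 1/2"
  shows "eventually (\<lambda>V. summable (\<lambda>j. excited_sum \<beta> a1 a2 a3 V (Suc j))) at_top"
    and "((\<lambda>V. (\<Sum>j. excited_sum \<beta> a1 a2 a3 V (Suc j)) / V) \<longlongrightarrow> rho_c \<beta>) at_top"
proof -
  have a: "a1 > 0" "a2 > 0" using assms by auto
  obtain C where C: "\<And>V j. V \<ge> 1 \<Longrightarrow> j \<ge> 1 \<Longrightarrow> excited_sum \<beta> a1 a2 a3 V j / V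
     \<le> C * (real j powr (-3/2) + real j powr (- (1 / (2 * a1))))"
    using excited_sum_bound[OF assms] by blast
  define M where "M = (\<lambda>j. C * (real (Suc j) powr (-3/2) + real (Suc j) powr (- (1 / (2 * a1)))))"
  have "summable (\<lambda>j. C * (real j powr (-3/2) + real j powr (- (1 / (2 * a1)))))"
    using a assms by (intro summable_mult summable_add) (auto simp: summable_real_powr_iff field_simps)
  then have M: "summable M" unfolding M_def by (subst summable_Suc_iff)
  have nn: "excited_sum \<beta> a1 a2 a3 V (Suc j) \<ge> 0" if "V > 0" for V j
  proof -
    have "1 \<le> theta (scaled_energy \<beta> V a (Suc j))" for a
      using that assms by (intro theta_bounds scaled_energy_pos) auto
    then have "1 * (1 * 1) \<le> theta (scaled_energy \<beta> V a1 (Suc j))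
     * (theta (scaled_energy \<beta> V a2 (Suc j)) * theta (scaled_energy \<beta> V a3 (Suc j)))"
      by (intro mult_mono) (auto intro: order_trans[OF zero_le_one])
    then show ?thesis by (simp add: excited_sum_def)
  qed
  have ev: "eventually (\<lambda>(j, V). norm (excited_sum \<beta> a1 a2 a3 V (Suc j) / V) \<le> M j) (at_top \<times>\<^sub>F at_top)"
    unfolding eventually_prod_filter
  proof (intro exI conjI allI impI)
    show "eventually (\<lambda>j::nat. True) at_top" by simp
    show "eventually (\<lambda>V::real. V \<ge> 1) at_top" by (rule eventually_ge_at_top)
    show "case (j, V) of (j, V) \<Rightarrow> norm (excited_sum \<beta> a1 a2 a3 V (Suc j) / V) \<le> M j"
      if "V \<ge> 1" for j V using nn[of V j] C[OF that, of "Suc j"] that by (simp add: M_def)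
  qed
  have lim: "((\<lambda>V. excited_sum \<beta> a1 a2 a3 V (Suc j) / V) \<longlongrightarrow>
      (2 * pi * \<beta> * real (Suc j)) powr (-3/2)) at_top" for j
    by (rule excited_sum_tendsto[OF assms(1) a assms(4,5)]) simp
  note T = tannerys_theorem[where a = "\<lambda>j V. excited_sum \<beta> a1 a2 a3 V (Suc j) / V"
      and b = "\<lambda>j. (2 * pi * \<beta> * real (Suc j)) powr (-3/2)" and M = M, OF lim ev M trivial_limit_at_top_linorder]
  have T: "eventually (\<lambda>V. summable (\<lambda>j. norm (excited_sum \<beta> a1 a2 a3 V (Suc j) / V))) at_top"
    "((\<lambda>V. \<Sum>j. excited_sum \<beta> a1 a2 a3 V (Suc j) / V) \<longlongrightarrow> (\<Sum>j. (2 * pi * \<beta> * real (Suc j)) powr (-3/2))) at_top"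
    using T by blast+
  show sm: "eventually (\<lambda>V. summable (\<lambda>j. excited_sum \<beta> a1 a2 a3 V (Suc j))) at_top"
    using T(1) eventually_gt_at_top[of "0::real"]
  proof eventually_elim
    case (elim V)
    from summable_mult[OF summable_norm_cancel[OF elim(1)], of V] elim(2) show ?case by simp
  qed
  have "eventually (\<lambda>V. (\<Sum>j. excited_sum \<beta> a1 a2 a3 V (Suc j) / V)
      = (\<Sum>j. excited_sum \<beta> a1 a2 a3 V (Suc j)) / V) at_top"
    using sm by eventually_elim (rule suminf_divide)
  then show "((\<lambda>V. (\<Sum>j. excited_sum \<beta> a1 a2 a3 V (Suc j)) / V) \<longlongrightarrow> rho_c \<beta>) at_top"
    using T(2) sums_unique[OF rho_c_sums[OF assms(1)]] by (simp add: tendsto_cong)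
qed

text \<open>An excited mode has some \<open>n_j\<close> at least 2, and for \<open>V \<ge> 1\<close>
  the longest axis has the smallest energy scale. The constant is not sharp; only the power of
  \<open>V\<close> matters.\<close>

lemma spectral_gap:
  assumes "V \<ge> 1" "a1 \<ge> a2" "a2 \<ge> a3" "k \<in> modes" "k \<noteq> (1, 1, 1)"
  shows "V powr (-2 * a1) \<le> eps a1 a2 a3 V k - eps a1 a2 a3 V (1, 1, 1)"
proof -
  obtain n1 n2 n3 where k: "k = (n1, n2, n3)" by (cases k) auto
  have n: "n1 \<ge> 1" "n2 \<ge> 1" "n3 \<ge> 1" using assms k by (auto simp: modes_def)
  define d where "d = (\<lambda>n::nat. real n ^ 2 - 1)"
  have d0: "d m \<ge> 0" if "m \<ge> 1" for m using that by (simp add: d_def)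
  have d1: "d m \<ge> 1" if "m \<ge> 1" "m \<noteq> 1" for m
  proof -
    have "(2::real)^2 \<le> real m ^ 2" using that by (intro power_mono) auto
    then show ?thesis by (simp add: d_def)
  qed
  let ?v = "V powr (-2 * a1)"
  have v: "?v \<le> V powr (-2 * a2)" "?v \<le> V powr (-2 * a3)"
    using assms by (auto intro!: powr_mono)
  have sum1: "1 \<le> d n1 + d n2 + d n3"
    using d0[OF n(1)] d0[OF n(2)] d0[OF n(3)] d1[OF n(1)] d1[OF n(2)] d1[OF n(3)] assms(5) k by force
  have "?v = 1 * (1 * ?v)" by simp
  also have "\<dots> \<le> (pi^2 / 2) * ((d n1 + d n2 + d n3) * ?v)"
  proof (intro mult_mono)
    have "2^2 \<le> pi^2" using pi_ge_two by (intro power_mono) auto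
    then show "1 \<le> pi^2 / 2" by simp
  qed (use sum1 in auto)
  also have "(d n1 + d n2 + d n3) * ?v \<le> d n1 * ?v + d n2 * V powr (-2 * a2) + d n3 * V powr (-2 * a3)"
    using v d0[OF n(2)] d0[OF n(3)] by (auto simp: distrib_right intro!: add_mono mult_left_mono)
  also have "(pi^2 / 2) * \<dots> = eps a1 a2 a3 V k - eps a1 a2 a3 V (1, 1, 1)"
    by (simp add: k eps_def d_def algebra_simps)
  finally show ?thesis by (simp add: mult_left_mono)
qed

text \<open>Since \<open>1 / (1 - exp (- x)) \<le> 1 / x + 1\<close>, the inverse gap grows at most
  like \<open>V powr (2 * a)\<close> plus a constant, which is \<open>o(V)\<close> when
  \<open>a < 1/2\<close>.\<close>

lemma inverse_gap_tendsto:
  fixes a \<beta> :: real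
  assumes "\<beta> > 0" "a < 1/2"
  shows "((\<lambda>V. 1 / (1 - exp (- \<beta> * V powr (-2 * a))) / V) \<longlongrightarrow> 0) at_top"
proof (rule tendsto_sandwich[OF _ _ tendsto_const])
  have b: "0 \<le> 1 / (1 - exp (- x)) \<and> 1 / (1 - exp (- x)) \<le> 1 / x + 1" if "x > 0" for x :: real
  proof -
    have "exp (- x) \<le> 1 / (1 + x)"
      using exp_ge_add_one_self[of x] that by (simp add: exp_minus field_simps)
    then have "x / (1 + x) \<le> 1 - exp (- x)" using that by (simp add: field_simps)
    moreover have "0 < x / (1 + x)" using that by simp
    ultimately have "1 / (1 - exp (- x)) \<le> 1 / (x / (1 + x))"
      by (intro frac_le) linarith+
    moreover have "0 < 1 - exp (- x)" using that by simp
    ultimately show ?thesis using that by (simp add: field_simps)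
  qed
  have x: "\<beta> * V powr (-2 * a) > 0" if "V > 0" for V using that assms by simp
  show "eventually (\<lambda>V. 0 \<le> 1 / (1 - exp (- \<beta> * V powr (-2 * a))) / V) at_top"
    using eventually_gt_at_top[of "0::real"]
    by eventually_elim (use b[OF x] in simp)
  show "eventually (\<lambda>V. 1 / (1 - exp (- \<beta> * V powr (-2 * a))) / V
      \<le> (1 / (\<beta> * V powr (-2 * a)) + 1) / V) at_top"
    using eventually_gt_at_top[of "0::real"]
    by eventually_elim (rule divide_right_mono, use b[OF x] in auto)
  have "((\<lambda>V. V powr (2 * a - 1) / \<beta> + 1 / V) \<longlongrightarrow> 0 / \<beta> + 0) at_top"
    using assms
    by (intro tendsto_add tendsto_divide tendsto_const tendsto_neg_powr filterlim_ident
        tendsto_divide_0[OF tendsto_const] filterlim_at_top_imp_at_infinity) auto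
  moreover have "eventually (\<lambda>V. V powr (2 * a - 1) / \<beta> + 1 / V = (1 / (\<beta> * V powr (-2 * a)) + 1) / V) at_top"
    using eventually_gt_at_top[of "0::real"]
    by eventually_elim (use assms in \<open>simp add: powr_diff powr_minus field_simps\<close>)
  ultimately show "((\<lambda>V. (1 / (\<beta> * V powr (-2 * a)) + 1) / V) \<longlongrightarrow> 0) at_top"
    by (simp add: tendsto_cong)
qed

section \<open>Assembly of the limit\<close>

theorem theorem3p14:
  fixes a1 a2 a3 \<beta> \<rho> :: real and n :: mode
  assumes "a1 \<ge> a2" and "a2 \<ge> a3" and "a3 > 0" and "a1 + a2 + a3 = 1"
    and "a1 < 1/2" and "\<beta> > 0" and "\<rho> > rho_c \<beta>" and "n \<in> modes"
  shows "(\<lambda>N::nat. occ_can \<beta> (eps a1 a2 a3 (real N / \<rho>)) N n / (real N / \<rho>))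
           \<longlonglongrightarrow> (if n = (1, 1, 1) then \<rho> - rho_c \<beta> else 0)"
proof -
  let ?g = "(1, 1, 1) :: mode"
  \<comment> \<open>Nonnegativity makes \<open>\<rho>\<close> positive, so the volumes
    \<open>N / \<rho>\<close> tend to infinity.\<close>
  have "rho_c \<beta> \<ge> 0"
    by (rule sums_le[OF _ sums_zero rho_c_sums[OF assms(6)]]) simp
  then have \<rho>: "\<rho> > 0" using assms by simp
  have V: "filterlim (\<lambda>N. real N / \<rho>) at_top sequentially"
    using \<rho> by real_asymp
  define A where "A = (\<lambda>V. \<Sum>j. excited_sum \<beta> a1 a2 a3 V (Suc j))"
  define R where "R = (\<lambda>V. exp (- \<beta> * V powr (-2 * a1)))"
  have lims: "eventually (\<lambda>V. summable (\<lambda>j. excited_sum \<beta> a1 a2 a3 V (Suc j))) at_top"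
    "((\<lambda>V. A V / V) \<longlongrightarrow> rho_c \<beta>) at_top"
    unfolding A_def by (rule critical_density_limit[OF assms(6) assms(1-5)])+
  have gap: "((\<lambda>V. 1 / (1 - R V) / V) \<longlongrightarrow> 0) at_top"
    unfolding R_def by (rule inverse_gap_tendsto[OF assms(6,5)])
  have "eventually (\<lambda>V. A V / V < \<rho>) at_top"
    using lims(2) assms(7) by (rule order_tendstoD)
  then have ev: "eventually (\<lambda>V. V \<ge> 1 \<and> A V / V < \<rho> \<and> summable (\<lambda>j. excited_sum \<beta> a1 a2 a3 V (Suc j))) at_top"
    using lims(1) eventually_ge_at_top[of "1::real"] by eventually_elim auto
  \<comment> \<open>At a fixed volume \<open>occ_can_bounds\<close> is applied to energies measured
    from the ground state. After division by \<open>V\<close> the conditioning error is a factor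
    with a finite limit times the inverse gap per volume.\<close>
  have bounds: "\<rho> - A V / V \<le> occ_can \<beta> (eps a1 a2 a3 V) N ?g / V
      \<and> occ_can \<beta> (eps a1 a2 a3 V) N ?g / V
         \<le> \<rho> - A V / V + \<rho> * (A V / V) / (\<rho> - A V / V)^2 * (1 / (1 - R V) / V)
      \<and> (n \<noteq> ?g \<longrightarrow> 0 \<le> occ_can \<beta> (eps a1 a2 a3 V) N n / V
          \<and> occ_can \<beta> (eps a1 a2 a3 V) N n / V \<le> 1 / (1 - R V) / V)"
    if V: "V \<ge> 1 \<and> A V / V < \<rho> \<and> summable (\<lambda>j. excited_sum \<beta> a1 a2 a3 V (Suc j))"
      and N: "real N = \<rho> * V" for V N
  proof -
    have V1: "V \<ge> 1" and AV: "A V / V < \<rho>" using V by auto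
    have V0: "V > 0" using V1 by simp
    define e where "e = (\<lambda>k. eps a1 a2 a3 V k - eps a1 a2 a3 V ?g)"
    have hs: "((\<lambda>k. exp (- \<beta> * e k) ^ j) has_sum (1 + excited_sum \<beta> a1 a2 a3 V j)) modes" if "j \<ge> 1" for j
      unfolding e_def by (rule boltzmann_power_has_sum[OF assms(6) V0 that])
    have x: "(\<lambda>k. exp (- \<beta> * e k)) summable_on modes"
      using has_sum_imp_summable[OF hs[of 1]] by simp
    have g: "?g \<in> modes" "e ?g = 0" by (auto simp: modes_def e_def)
    have r: "0 \<le> R V" "R V < 1" using assms(6) V0 by (auto simp: R_def)
    have le: "exp (- \<beta> * e k) \<le> R V" if "k \<in> modes" "k \<noteq> ?g" for k
      using spectral_gap[OF V1 assms(1,2) that] assms(6) by (simp add: R_def e_def)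
    have a: "(\<lambda>j. excited_sum \<beta> a1 a2 a3 V (Suc j)) sums A V"
      unfolding A_def using V by (intro summable_sums) auto
    have O1: "real N - A V \<le> occ_can \<beta> e N ?g"
      by (rule occ_can_bounds(1)[OF x g r le hs a])
    have O2: "occ_can \<beta> e N ?g \<le> real N - A V + real N * (A V / (1 - R V)) / (real N - A V)^2"
      if "real N > A V"
      by (rule occ_can_bounds(2)[OF x g r le hs a that])
    have O3: "0 \<le> occ_can \<beta> e N n \<and> occ_can \<beta> e N n \<le> 1 / (1 - R V)" if "n \<noteq> ?g"
      by (rule occ_can_bounds(3)[OF x g r le hs a assms(8) that])
    have occ: "occ_can \<beta> e N k = occ_can \<beta> (eps a1 a2 a3 V) N k" for k
      unfolding e_def by (rule occ_can_shift)
    have NA: "real N > A V" using AV V0 by (simp add: N field_simps)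
    have "(real N - A V) / V \<le> occ_can \<beta> e N ?g / V"
      using O1 V0 by (intro divide_right_mono) auto
    moreover have "(real N - A V) / V = \<rho> - A V / V" using V0 by (simp add: N field_simps)
    moreover have "occ_can \<beta> e N ?g / V
        \<le> (real N - A V + real N * (A V / (1 - R V)) / (real N - A V)^2) / V"
      using O2 NA V0 by (intro divide_right_mono) auto
    moreover have "real N * (A V / (1 - R V)) / (real N - A V)^2 / V
        = \<rho> * (A V / V) / (\<rho> - A V / V)^2 * (1 / (1 - R V) / V)"
    proof -
      have "real N - A V = V * (\<rho> - A V / V)" using V0 by (simp add: N field_simps)
      then have "(real N - A V)^2 = V^2 * (\<rho> - A V / V)^2" by (simp add: power_mult_distrib)
      then show ?thesis using V0 by (simp add: N power2_eq_square)
    qed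
    moreover have "0 \<le> occ_can \<beta> e N n / V \<and> occ_can \<beta> e N n / V \<le> 1 / (1 - R V) / V" if "n \<noteq> ?g"
      using O3[OF that] V0 by (intro conjI divide_nonneg_pos divide_right_mono) auto
    ultimately show ?thesis unfolding occ by (auto simp: add_divide_distrib)
  qed
  have evN: "eventually (\<lambda>N. real N / \<rho> \<ge> 1 \<and> A (real N / \<rho>) / (real N / \<rho>) < \<rho>
      \<and> summable (\<lambda>j. excited_sum \<beta> a1 a2 a3 (real N / \<rho>) (Suc j))) sequentially"
    using eventually_compose_filterlim[OF ev V] .
  have bN: "\<And>N. real N = \<rho> * (real N / \<rho>)" using \<rho> by simp
  show ?thesis
  proof (cases "n = ?g")
    case True
    \<comment> \<open>Because \<open>\<rho> > rho_c \<beta>\<close>, the denominator has a nonzero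
      limit, so the error vanishes with the inverse gap per volume and both bounds share one
      limit.\<close>
    have U: "((\<lambda>V. \<rho> - A V / V + \<rho> * (A V / V) / (\<rho> - A V / V)^2 * (1 / (1 - R V) / V)) \<longlongrightarrow>
        \<rho> - rho_c \<beta> + \<rho> * rho_c \<beta> / (\<rho> - rho_c \<beta>)^2 * 0) at_top"
      using assms(7) by (intro tendsto_intros lims(2) gap) auto
    have L: "((\<lambda>V. \<rho> - A V / V) \<longlongrightarrow> \<rho> - rho_c \<beta>) at_top"
      by (intro tendsto_intros lims(2))
    have "(\<lambda>N::nat. occ_can \<beta> (eps a1 a2 a3 (real N / \<rho>)) N ?g / (real N / \<rho>)) \<longlonglongrightarrow> \<rho> - rho_c \<beta>"
    proof (rule tendsto_sandwich)
      show "(\<lambda>N. \<rho> - A (real N / \<rho>) / (real N / \<rho>)) \<longlonglongrightarrow> \<rho> - rho_c \<beta>"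
        by (rule filterlim_compose[OF L V])
      show "(\<lambda>N. \<rho> - A (real N / \<rho>) / (real N / \<rho>) + \<rho> * (A (real N / \<rho>) / (real N / \<rho>))
          / (\<rho> - A (real N / \<rho>) / (real N / \<rho>))^2 * (1 / (1 - R (real N / \<rho>)) / (real N / \<rho>))) \<longlonglongrightarrow> \<rho> - rho_c \<beta>"
        using filterlim_compose[OF U V] by simp
    qed (use evN in eventually_elim, use bounds[OF _ bN] in blast)+
    then show ?thesis using True by simp
  next
    case False
    have "(\<lambda>N::nat. occ_can \<beta> (eps a1 a2 a3 (real N / \<rho>)) N n / (real N / \<rho>)) \<longlonglongrightarrow> 0"
    proof (rule tendsto_sandwich[OF _ _ tendsto_const])
      show "(\<lambda>N. 1 / (1 - R (real N / \<rho>)) / (real N / \<rho>)) \<longlonglongrightarrow> 0"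
        by (rule filterlim_compose[OF gap V])
    qed (use evN in eventually_elim, use bounds[OF _ bN] False in blast)+
    then show ?thesis using False by simp
  qed
qed

end
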